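(* The category $\mathsf{ESLata}$ of E-SLatas and the category $\mathsf{ESLataSp}$ of ESLata-spaces are dually equivalent.
   Context: SEMILATTICES. A semilattice is an algebra $\mathbf{A}=\langle A,\wedge,1\rangle$ with $\wedge$ idempotent, commutative, associative and $a\wedge 1=a$ for all $a$; its order is $a\le b$ iff $a=a\wedge b$. A homomorphism preserves $\wedge$ and $1$. For unary operators $f,g$ on $A$, $f\dashv g$ means: for all $a,b\in A$, $f(a)\le b$ iff $a\le g(b)$. An E-SLata is $\langle\mathbf{A},P,G,F,H\rangle$ with $\mathbf{A}$ a semilattice and $P,G,F,H$ unary operators on $A$ with (T1) $P\dashv G$; (T2) $F\dashv H$; (T3) $G(x)\wedge F(y)\le F(x\wedge y)$ and $H(x)\wedge P(y)\le P(x\wedge y)$ for all $x,y$. $\mathsf{ESLata}$ is the category of E-SLatas and semilattice homomorphisms preserving $P,G,F,H$, with usual composition and identities. S-SPACES. A pair $\langle X,\mathcal{K}\rangle$ denotes a set $X$ with the topology having $\mathcal{K}$, a family of subsets of $X$, as subbase. Put $S(X)=\{U^c:U\in\mathcal{K}\}$ (complements in $X$) and $C_{\mathcal{K}}(X)=\{\bigcap\mathcal{A}:\mathcal{A}\subseteq S(X)\}$. For $Y\subseteq X$, a nonempty $\mathcal{J}\subseteq S(X)$ is a $Y$-family if for all $A,B\in\mathcal{J}$ there are $H,C\in S(X)$ with $Y\subseteq H$, $C\in\mathcal{J}$, $A\cap H\subseteq C$ and $B\cap H\subseteq C$. $\langle X,\mathcal{K}\rangle$ is an $S$-space if: (S1)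 it is $T_0$ and $X=\bigcup\mathcal{K}$; (S2) $\mathcal{K}$ is a subbase of compact open subsets, closed under finite unions, with $\emptyset\in\mathcal{K}$; (S3) for $U,V\in\mathcal{K}$ and $x\in U\cap V$ there are $W,D\in\mathcal{K}$ with $x\notin W$, $x\in D$, $D\subseteq(U\cap V)\cup W$; (S4) if $Y\in C_{\mathcal{K}}(X)$ and $\mathcal{J}$ is a $Y$-family with $Y\cap A^c\ne\emptyset$ for all $A\in\mathcal{J}$, then $Y\cap\bigcap\{A^c:A\in\mathcal{J}\}\neq\emptyset$. SLATA-SPACES. For an $S$-space $\langle X,\mathcal{K}\rangle$, $\mathcal{Z}(X)$ is the set of subsets of $X$ that are (possibly infinite) intersections of members of $\mathcal{K}$; for $U\in S(X)$, $L_U=\{Z\in\mathcal{Z}(X):Z\cap U\ne\emptyset\}$. For $R\subseteq X\times\mathcal{Z}(X)$ let $R(x)=\{Z:(x,Z)\in R\}$ and $m_R(U)=\{x\in X:R(x)\subseteq L_U\}$. $\langle X,\mathcal{K},R\rangle$ is an $mS$-space if $m_R(U)\in S(X)$ for all $U\in S(X)$ and $R(x)=\bigcap\{L_U:U\in S(X),x\in m_R(U)\}$ for all $x\in X$. $\langle X,\mathcal{K},I,D\rangle$ is an SLata-space if: (1) $\langle X,\mathcal{K},I\rangle$ and $\langle X,\mathcal{K},D\rangle$ are $mS$-spaces; (2) for every $U\in S(X)$, if $x\in U$ then for every $Z\in D(x)$ there is $w\in Z$ with $I(w)\subseteq L_U$; (3) for every $U\in S(X)$ and $x\in X$, if for every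 $Z\in I(x)$ there is $y\in Z$ with $D(y)\subseteq L_U$, then $x\in U$. ESLATA-SPACES. $\langle X,\mathcal{K},I_1,D_1,I_2,D_2\rangle$ is an ESLata-space (E-SLata space) if (E1) $\langle X,\mathcal{K},I_1,D_1\rangle$ and $\langle X,\mathcal{K},I_2,D_2\rangle$ are SLata-spaces; (E2) for all $x\in X$, $U,V\in S(X)$: if $D_1(x)\subseteq L_U$ and $I_2(x)\subseteq L_V$ then $I_2(x)\subseteq L_{U\cap V}$; (E3) for all $x\in X$, $U,V\in S(X)$: if $D_2(x)\subseteq L_U$ and $I_1(x)\subseteq L_V$ then $I_1(x)\subseteq L_{U\cap V}$. RELATIONS. For $T\subseteq X_1\times X_2$ let $T(x)=\{y:(x,y)\in T\}$ and $\Box_T(U)=\{x\in X_1:T(x)\subseteq U\}$. A meet-relation between $S$-spaces is $T\subseteq X_1\times X_2$ with $\Box_T(U)\in S(X_1)$ for all $U\in S(X_2)$ and $T(x)=\bigcap\{U\in S(X_2):T(x)\subseteq U\}$ for all $x\in X_1$. An SLata-relation between SLata-spaces $\langle X_1,\mathcal{K}_1,I,D\rangle$ and $\langle X_2,\mathcal{K}_2,J,M\rangle$ is a meet-relation $T$ with $\Box_T\circ m_{J}=m_{I}\circ\Box_T$ and $\Box_T\circ m_{M}=m_{D}\circ\Box_T$ on $S(X_2)$. An ESLata-relation from $\langle X_1,\mathcal{K}_1,I_1,D_1,I_2,D_2\rangle$ to $\langle X_2,\mathcal{K}_2,J_1,M_1,J_2,M_2\rangle$ is a $T\subseteq X_1\times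 X_2$ that is an SLata-relation between $\langle X_1,\mathcal{K}_1,I_l,D_l\rangle$ and $\langle X_2,\mathcal{K}_2,J_l,M_l\rangle$ for $l=1,2$. For $R\subseteq X_1\times X_2$ and $T\subseteq X_2\times X_3$, $T\ast R=\{(x,z)\in X_1\times X_3:\forall U\in S(X_3)\,[(T\circ R)(x)\subseteq U\Rightarrow z\in U]\}$, where $T\circ R$ is the usual relational composition ($R$ first). $\mathsf{ESLataSp}$ is the category of ESLata-spaces and ESLata-relations with composition $\ast$ and identity on $X$ the dual specialization order $\sqsupseteq$ ($x\sqsupseteq y$ iff $y\in\mathrm{cl}(\{x\})$). *)

theory Defs
  imports "HOL-Analysis.Abstract_Topological_Spaces" "HOL-Algebra.Group"
begin

section \<open>Categories\<close>

text \<open>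
  Arrows are given by a hom-family indexed by source and target. The hom-sets need not be disjoint,
  so composition and the arrow part of a functor take the objects as arguments:
  \<open>Comp C a b c g f\<close> is \<open>g\<close> after \<open>f\<close> for \<open>f : a \<rightarrow> b\<close> and \<open>g : b \<rightarrow> c\<close>.
\<close>

record ('o, 'm) cat =
  Obj  :: "'o set"
  Hom  :: "'o \<Rightarrow> 'o \<Rightarrow> 'm set"
  Idt  :: "'o \<Rightarrow> 'm"
  Comp :: "'o \<Rightarrow> 'o \<Rightarrow> 'o \<Rightarrow> 'm \<Rightarrow> 'm \<Rightarrow> 'm"

definition category :: "('o, 'm) cat \<Rightarrow> bool" where
  "category C \<longleftrightarrow>
     (\<forall>a \<in> Obj C. Idt C a \<in> Hom C a a) \<and>
     (\<forall>a \<in> Obj C. \<forall>b \<in> Obj C. \<forall>c \<in> Obj C. \<forall>f \<in> Hom C a b. \<forall>g \<in> Hom C b c.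
        Comp C a b c g f \<in> Hom C a c) \<and>
     (\<forall>a \<in> Obj C. \<forall>b \<in> Obj C. \<forall>f \<in> Hom C a b.
        Comp C a a b f (Idt C a) = f \<and> Comp C a b b (Idt C b) f = f) \<and>
     (\<forall>a \<in> Obj C. \<forall>b \<in> Obj C. \<forall>c \<in> Obj C. \<forall>d \<in> Obj C.
        \<forall>f \<in> Hom C a b. \<forall>g \<in> Hom C b c. \<forall>h \<in> Hom C c d.
        Comp C a b d (Comp C b c d h g) f = Comp C a c d h (Comp C a b c g f))"

definition op_cat :: "('o, 'm) cat \<Rightarrow> ('o, 'm) cat" where
  "op_cat C = \<lparr>Obj = Obj C, Hom = (\<lambda>a b. Hom C b a), Idt = Idt C,
               Comp = (\<lambda>a b c g f. Comp C c b a f g)\<rparr>"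

definition is_functor ::
  "('o, 'm) cat \<Rightarrow> ('p, 'n) cat \<Rightarrow> ('o \<Rightarrow> 'p) \<Rightarrow> ('o \<Rightarrow> 'o \<Rightarrow> 'm \<Rightarrow> 'n) \<Rightarrow> bool" where
  "is_functor C D Fo Fa \<longleftrightarrow>
     (\<forall>a \<in> Obj C. Fo a \<in> Obj D) \<and>
     (\<forall>a \<in> Obj C. \<forall>b \<in> Obj C. \<forall>f \<in> Hom C a b. Fa a b f \<in> Hom D (Fo a) (Fo b)) \<and>
     (\<forall>a \<in> Obj C. Fa a a (Idt C a) = Idt D (Fo a)) \<and>
     (\<forall>a \<in> Obj C. \<forall>b \<in> Obj C. \<forall>c \<in> Obj C. \<forall>f \<in> Hom C a b. \<forall>g \<in> Hom C b c.
        Fa a c (Comp C a b c g f) = Comp D (Fo a) (Fo b) (Fo c) (Fa b c g) (Fa a b f))"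

definition is_iso :: "('o, 'm) cat \<Rightarrow> 'o \<Rightarrow> 'o \<Rightarrow> 'm \<Rightarrow> bool" where
  "is_iso C a b f \<longleftrightarrow> f \<in> Hom C a b \<and>
     (\<exists>g \<in> Hom C b a. Comp C a b a g f = Idt C a \<and> Comp C b a b f g = Idt C b)"

definition nat_isomorphic ::
  "('o, 'm) cat \<Rightarrow> ('p, 'n) cat \<Rightarrow> ('o \<Rightarrow> 'p) \<Rightarrow> ('o \<Rightarrow> 'o \<Rightarrow> 'm \<Rightarrow> 'n)
     \<Rightarrow> ('o \<Rightarrow> 'p) \<Rightarrow> ('o \<Rightarrow> 'o \<Rightarrow> 'm \<Rightarrow> 'n) \<Rightarrow> bool" where
  "nat_isomorphic C D Fo Fa Go Ga \<longleftrightarrow>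
     (\<exists>\<tau>. (\<forall>a \<in> Obj C. is_iso D (Fo a) (Go a) (\<tau> a)) \<and>
          (\<forall>a \<in> Obj C. \<forall>b \<in> Obj C. \<forall>f \<in> Hom C a b.
             Comp D (Fo a) (Fo b) (Go b) (\<tau> b) (Fa a b f) =
             Comp D (Fo a) (Go a) (Go b) (Ga a b f) (\<tau> a)))"

definition equivalent_cats :: "('o, 'm) cat \<Rightarrow> ('p, 'n) cat \<Rightarrow> bool" where
  "equivalent_cats C D \<longleftrightarrow> category C \<and> category D \<and>
     (\<exists>Fo Fa Go Ga. is_functor C D Fo Fa \<and> is_functor D C Go Ga \<and>
        nat_isomorphic C C (\<lambda>a. a) (\<lambda>a b f. f)
          (\<lambda>a. Go (Fo a)) (\<lambda>a b f. Ga (Fo a) (Fo b) (Fa a b f)) \<and>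
        nat_isomorphic D D (\<lambda>a. a) (\<lambda>a b f. f)
          (\<lambda>a. Fo (Go a)) (\<lambda>a b f. Fa (Go a) (Go b) (Ga a b f)))"

definition dually_equivalent :: "('o, 'm) cat \<Rightarrow> ('p, 'n) cat \<Rightarrow> bool" where
  "dually_equivalent C D \<longleftrightarrow> equivalent_cats (op_cat C) D"


section \<open>E-SLatas\<close>

text \<open>
  A semilattice \<open>\<langle>A, \<and>, 1\<rangle>\<close> is an idempotent commutative monoid; the meet is written \<open>\<otimes>\<close> and the top
  element \<open>\<one>\<close>, as in HOL-Algebra.
\<close>

record 'a eslata = "'a monoid" +
  opP :: "'a \<Rightarrow> 'a"
  opG :: "'a \<Rightarrow> 'a"
  opF :: "'a \<Rightarrow> 'a"
  opH :: "'a \<Rightarrow> 'a"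

definition meet_semilattice :: "('a, 'z) monoid_scheme \<Rightarrow> bool" where
  "meet_semilattice A \<longleftrightarrow> comm_monoid A \<and> (\<forall>x \<in> carrier A. x \<otimes>\<^bsub>A\<^esub> x = x)"

definition sle :: "('a, 'z) monoid_scheme \<Rightarrow> 'a \<Rightarrow> 'a \<Rightarrow> bool" where
  "sle A a b \<longleftrightarrow> a = a \<otimes>\<^bsub>A\<^esub> b"

definition adjoint_ops :: "('a, 'z) monoid_scheme \<Rightarrow> ('a \<Rightarrow> 'a) \<Rightarrow> ('a \<Rightarrow> 'a) \<Rightarrow> bool" where
  "adjoint_ops A f g \<longleftrightarrow>
     (\<forall>a \<in> carrier A. \<forall>b \<in> carrier A. sle A (f a) b \<longleftrightarrow> sle A a (g b))"

definition is_eslata :: "'a eslata \<Rightarrow> bool" where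
  "is_eslata A \<longleftrightarrow> meet_semilattice A \<and>
     opP A \<in> carrier A \<rightarrow> carrier A \<and> opG A \<in> carrier A \<rightarrow> carrier A \<and>
     opF A \<in> carrier A \<rightarrow> carrier A \<and> opH A \<in> carrier A \<rightarrow> carrier A \<and>
     adjoint_ops A (opP A) (opG A) \<and>
     adjoint_ops A (opF A) (opH A) \<and>
     (\<forall>x \<in> carrier A. \<forall>y \<in> carrier A.
        sle A (opG A x \<otimes>\<^bsub>A\<^esub> opF A y) (opF A (x \<otimes>\<^bsub>A\<^esub> y)) \<and>
        sle A (opH A x \<otimes>\<^bsub>A\<^esub> opP A y) (opP A (x \<otimes>\<^bsub>A\<^esub> y)))"

text \<open>Homomorphisms are extensional, so that equality of arrows is equality on the carrier.\<close>

definition eslata_hom :: "'a eslata \<Rightarrow> 'b eslata \<Rightarrow> ('a \<Rightarrow> 'b) set" where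
  "eslata_hom A B = {h \<in> hom A B \<inter> extensional (carrier A).
     h \<one>\<^bsub>A\<^esub> = \<one>\<^bsub>B\<^esub> \<and>
     (\<forall>x \<in> carrier A. h (opP A x) = opP B (h x) \<and> h (opG A x) = opG B (h x) \<and>
                      h (opF A x) = opF B (h x) \<and> h (opH A x) = opH B (h x))}"


section \<open>S-spaces\<close>

definition subbase_topology :: "'b set \<Rightarrow> 'b set set \<Rightarrow> 'b topology" where
  "subbase_topology X \<K> =
     topology (arbitrary union_of (finite intersection_of (\<lambda>U. U \<in> \<K>) relative_to X))"

text \<open>
  \<open>co_subbase X \<K>\<close> is the family \<open>S(X)\<close>, \<open>closed_inters X \<K>\<close> is \<open>C\<^sub>\<K>(X)\<close> and \<open>sat_sets X \<K>\<close> is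
  \<open>\<Z>(X)\<close>. In the last two the empty intersection is \<open>X\<close>.
\<close>

definition co_subbase :: "'b set \<Rightarrow> 'b set set \<Rightarrow> 'b set set" where
  "co_subbase X \<K> = {X - U |U. U \<in> \<K>}"

definition closed_inters :: "'b set \<Rightarrow> 'b set set \<Rightarrow> 'b set set" where
  "closed_inters X \<K> = {X \<inter> \<Inter>\<A> |\<A>. \<A> \<subseteq> co_subbase X \<K>}"

definition sat_sets :: "'b set \<Rightarrow> 'b set set \<Rightarrow> 'b set set" where
  "sat_sets X \<K> = {X \<inter> \<Inter>\<W> |\<W>. \<W> \<subseteq> \<K>}"

definition Y_family :: "'b set \<Rightarrow> 'b set set \<Rightarrow> 'b set \<Rightarrow> 'b set set \<Rightarrow> bool" where
  "Y_family X \<K> Y \<J> \<longleftrightarrow> \<J> \<noteq> {} \<and> \<J> \<subseteq> co_subbase X \<K> \<and>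
     (\<forall>A \<in> \<J>. \<forall>B \<in> \<J>. \<exists>H \<in> co_subbase X \<K>. \<exists>C \<in> \<J>.
        Y \<subseteq> H \<and> A \<inter> H \<subseteq> C \<and> B \<inter> H \<subseteq> C)"

definition s_space :: "'b set \<Rightarrow> 'b set set \<Rightarrow> bool" where
  "s_space X \<K> \<longleftrightarrow>
     \<K> \<subseteq> Pow X \<and>
     t0_space (subbase_topology X \<K>) \<and> X = \<Union>\<K> \<and>
     (\<forall>U \<in> \<K>. compactin (subbase_topology X \<K>) U) \<and>
     (\<forall>U \<in> \<K>. \<forall>V \<in> \<K>. U \<union> V \<in> \<K>) \<and> {} \<in> \<K> \<and>
     (\<forall>U \<in> \<K>. \<forall>V \<in> \<K>. \<forall>x \<in> U \<inter> V. \<exists>W \<in> \<K>. \<exists>D \<in> \<K>.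
        x \<notin> W \<and> x \<in> D \<and> D \<subseteq> (U \<inter> V) \<union> W) \<and>
     (\<forall>Y \<in> closed_inters X \<K>. \<forall>\<J>.
        Y_family X \<K> Y \<J> \<and> (\<forall>A \<in> \<J>. Y \<inter> (X - A) \<noteq> {}) \<longrightarrow> Y \<inter> \<Inter>{X - A |A. A \<in> \<J>} \<noteq> {})"


section \<open>ESLata-spaces\<close>

text \<open>
  \<open>hits X \<K> U\<close> is \<open>L\<^sub>U\<close>, and \<open>m_op X \<K> R\<close> is the operator \<open>m\<^sub>R\<close>.
\<close>

definition hits :: "'b set \<Rightarrow> 'b set set \<Rightarrow> 'b set \<Rightarrow> 'b set set" where
  "hits X \<K> U = {Z \<in> sat_sets X \<K>. Z \<inter> U \<noteq> {}}"

definition m_op :: "'b set \<Rightarrow> 'b set set \<Rightarrow> ('b \<times> 'b set) set \<Rightarrow> 'b set \<Rightarrow> 'b set" where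
  "m_op X \<K> R U = {x \<in> X. R `` {x} \<subseteq> hits X \<K> U}"

text \<open>The intersection in the last clause is taken in \<open>\<Z>(X)\<close>; it can be empty-indexed.\<close>

definition mS_space :: "'b set \<Rightarrow> 'b set set \<Rightarrow> ('b \<times> 'b set) set \<Rightarrow> bool" where
  "mS_space X \<K> R \<longleftrightarrow> s_space X \<K> \<and> R \<subseteq> X \<times> sat_sets X \<K> \<and>
     (\<forall>U \<in> co_subbase X \<K>. m_op X \<K> R U \<in> co_subbase X \<K>) \<and>
     (\<forall>x \<in> X. R `` {x} =
        sat_sets X \<K> \<inter> \<Inter>{hits X \<K> U |U. U \<in> co_subbase X \<K> \<and> x \<in> m_op X \<K> R U})"

definition slata_space ::
  "'b set \<Rightarrow> 'b set set \<Rightarrow> ('b \<times> 'b set) set \<Rightarrow> ('b \<times> 'b set) set \<Rightarrow> bool" where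
  "slata_space X \<K> I D \<longleftrightarrow> mS_space X \<K> I \<and> mS_space X \<K> D \<and>
     (\<forall>U \<in> co_subbase X \<K>. \<forall>x \<in> U. \<forall>Z \<in> D `` {x}. \<exists>w \<in> Z. I `` {w} \<subseteq> hits X \<K> U) \<and>
     (\<forall>U \<in> co_subbase X \<K>. \<forall>x \<in> X.
        (\<forall>Z \<in> I `` {x}. \<exists>y \<in> Z. D `` {y} \<subseteq> hits X \<K> U) \<longrightarrow> x \<in> U)"

record 'b es_space =
  points  :: "'b set"
  subbase :: "'b set set"
  relI1   :: "('b \<times> 'b set) set"
  relD1   :: "('b \<times> 'b set) set"
  relI2   :: "('b \<times> 'b set) set"
  relD2   :: "('b \<times> 'b set) set"

definition is_eslata_space :: "'b es_space \<Rightarrow> bool" where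
  "is_eslata_space \<X> \<longleftrightarrow>
    (let X = points \<X>; \<K> = subbase \<X>; I1 = relI1 \<X>; D1 = relD1 \<X>; I2 = relI2 \<X>; D2 = relD2 \<X> in
       slata_space X \<K> I1 D1 \<and> slata_space X \<K> I2 D2 \<and>
       (\<forall>x \<in> X. \<forall>U \<in> co_subbase X \<K>. \<forall>V \<in> co_subbase X \<K>.
          D1 `` {x} \<subseteq> hits X \<K> U \<and> I2 `` {x} \<subseteq> hits X \<K> V \<longrightarrow> I2 `` {x} \<subseteq> hits X \<K> (U \<inter> V)) \<and>
       (\<forall>x \<in> X. \<forall>U \<in> co_subbase X \<K>. \<forall>V \<in> co_subbase X \<K>.
          D2 `` {x} \<subseteq> hits X \<K> U \<and> I1 `` {x} \<subseteq> hits X \<K> V \<longrightarrow> I1 `` {x} \<subseteq> hits X \<K> (U \<inter> V)))"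


section \<open>ESLata-relations\<close>

definition box_op :: "'b set \<Rightarrow> ('b \<times> 'c) set \<Rightarrow> 'c set \<Rightarrow> 'b set" where
  "box_op X T U = {x \<in> X. T `` {x} \<subseteq> U}"

definition meet_relation ::
  "'b set \<Rightarrow> 'b set set \<Rightarrow> 'c set \<Rightarrow> 'c set set \<Rightarrow> ('b \<times> 'c) set \<Rightarrow> bool" where
  "meet_relation X1 \<K>1 X2 \<K>2 T \<longleftrightarrow> T \<subseteq> X1 \<times> X2 \<and>
     (\<forall>U \<in> co_subbase X2 \<K>2. box_op X1 T U \<in> co_subbase X1 \<K>1) \<and>
     (\<forall>x \<in> X1. T `` {x} = \<Inter>{U \<in> co_subbase X2 \<K>2. T `` {x} \<subseteq> U})"

definition slata_relation ::
  "'b set \<Rightarrow> 'b set set \<Rightarrow> ('b \<times> 'b set) set \<Rightarrow> ('b \<times> 'b set) set \<Rightarrow>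
   'c set \<Rightarrow> 'c set set \<Rightarrow> ('c \<times> 'c set) set \<Rightarrow> ('c \<times> 'c set) set \<Rightarrow> ('b \<times> 'c) set \<Rightarrow> bool" where
  "slata_relation X1 \<K>1 I D X2 \<K>2 J M T \<longleftrightarrow> meet_relation X1 \<K>1 X2 \<K>2 T \<and>
     (\<forall>U \<in> co_subbase X2 \<K>2.
        box_op X1 T (m_op X2 \<K>2 J U) = m_op X1 \<K>1 I (box_op X1 T U) \<and>
        box_op X1 T (m_op X2 \<K>2 M U) = m_op X1 \<K>1 D (box_op X1 T U))"

definition eslata_relation :: "'b es_space \<Rightarrow> 'c es_space \<Rightarrow> ('b \<times> 'c) set \<Rightarrow> bool" where
  "eslata_relation \<X> \<Y> T \<longleftrightarrow>
     slata_relation (points \<X>) (subbase \<X>) (relI1 \<X>) (relD1 \<X>)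
                    (points \<Y>) (subbase \<Y>) (relI1 \<Y>) (relD1 \<Y>) T \<and>
     slata_relation (points \<X>) (subbase \<X>) (relI2 \<X>) (relD2 \<X>)
                    (points \<Y>) (subbase \<Y>) (relI2 \<Y>) (relD2 \<Y>) T"

definition star_comp ::
  "'b es_space \<Rightarrow> 'd es_space \<Rightarrow> ('c \<times> 'd) set \<Rightarrow> ('b \<times> 'c) set \<Rightarrow> ('b \<times> 'd) set" where
  "star_comp \<X>1 \<X>3 T R = {(x, z) \<in> points \<X>1 \<times> points \<X>3.
     \<forall>U \<in> co_subbase (points \<X>3) (subbase \<X>3). (R O T) `` {x} \<subseteq> U \<longrightarrow> z \<in> U}"

definition dual_specialization :: "'b es_space \<Rightarrow> ('b \<times> 'b) set" where
  "dual_specialization \<X> = {(x, y) \<in> points \<X> \<times> points \<X>.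
     y \<in> subbase_topology (points \<X>) (subbase \<X>) closure_of {x}}"


section \<open>The two categories\<close>

text \<open>
  No HOL type contains all E-SLatas or is closed under power sets, so both categories are taken
  relative to a family \<open>\<U>\<close> of carriers: \<open>ESLata \<U>\<close> has as objects the E-SLatas with carrier in \<open>\<U>\<close>,
  and \<open>ESLataSp \<U>\<close> the ESLata-spaces whose subbase has the cardinality of a member of \<open>\<U>\<close>.

  Choosing \<open>\<U>\<close> as the family of small subsets of a universe that is closed under power sets yields
  the usual categories of small structures: by \<open>small_space_iff\<close> below, the condition on a space then
  says that its set of points is small. Choosing \<open>\<U> = UNIV\<close> puts no condition on the carrier of an
  E-SLata except that it lives in \<open>'a\<close>. Every ESLata-space whose subbase injects into \<open>'a\<close> then
  occurs up to isomorphism, provided that \<open>'b\<close> is at least as large as \<open>'a set\<close> (a \<open>T\<^sub>0\<close> space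
  injects into the power set of its subbase). Since \<open>'a\<close> is arbitrary, all E-SLatas and all
  ESLata-spaces are covered.
\<close>

definition ESLata :: "'a set set \<Rightarrow> ('a eslata, 'a \<Rightarrow> 'a) cat" where
  "ESLata \<U> = \<lparr>Obj = {A. is_eslata A \<and> carrier A \<in> \<U>},
               Hom = eslata_hom,
               Idt = (\<lambda>A. restrict (\<lambda>x. x) (carrier A)),
               Comp = (\<lambda>A B C g f. compose (carrier A) g f)\<rparr>"

definition ESLataSp :: "'a set set \<Rightarrow> ('b es_space, ('b \<times> 'b) set) cat" where
  "ESLataSp \<U> = \<lparr>Obj = {\<X>. is_eslata_space \<X> \<and> (\<exists>A \<in> \<U>. subbase \<X> \<approx> A)},
                 Hom = (\<lambda>\<X> \<Y>. {T. eslata_relation \<X> \<Y> T}),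
                 Idt = dual_specialization,
                 Comp = (\<lambda>\<X>1 \<X>2 \<X>3 T R. star_comp \<X>1 \<X>3 T R)\<rparr>"

lemma s_space_points_lepoll:
  assumes "s_space X \<K>"
  shows "X \<lesssim> Pow \<K>"
proof -
  let ?f = "\<lambda>x. {U \<in> \<K>. x \<in> U}"
  have "inj_on ?f X"
  proof (rule inj_onI, rule ccontr)
    fix x y assume x: "x \<in> X" and y: "y \<in> X" and eq: "?f x = ?f y" and "x \<noteq> y"
    have agree: "x \<in> U \<longleftrightarrow> y \<in> U" if "U \<in> \<K>" for U
      using eq that by blast
    have top: "topspace (subbase_topology X \<K>) = X"
      by (simp add: subbase_topology_def)
    obtain U where U: "openin (subbase_topology X \<K>) U" and ne: "x \<notin> U \<longleftrightarrow> y \<in> U"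
    proof -
      have "t0_space (subbase_topology X \<K>)" using assms unfolding s_space_def by (elim conjE)
      then show thesis
        using that x y \<open>x \<noteq> y\<close> unfolding t0_space_def top by blast
    qed
    obtain \<B> where \<B>: "\<B> \<subseteq> Collect (finite intersection_of (\<lambda>U. U \<in> \<K>) relative_to X)"
        and "\<Union>\<B> = U"
      using U[unfolded subbase_topology_def openin_subbase] unfolding union_of_def by auto
    moreover have "x \<in> B \<longleftrightarrow> y \<in> B" if B: "B \<in> \<B>" for B
    proof -
      obtain \<F> where "\<F> \<subseteq> \<K>" "B = X \<inter> \<Inter>\<F>"
        using subsetD[OF \<B> B] unfolding relative_to_def intersection_of_def by auto
      then show ?thesis using agree x y by blast
    qed
    ultimately show False using ne by blast
  qed
  then show ?thesis
    unfolding lepoll_def by (intro exI[of _ ?f]) auto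
qed

lemma small_space_iff:
  fixes \<U> :: "'a set set" and X :: "'a set"
  assumes sub: "\<And>A B. A \<in> \<U> \<Longrightarrow> B \<lesssim> A \<Longrightarrow> B \<in> \<U>"
    and pow: "\<And>A. A \<in> \<U> \<Longrightarrow> \<exists>B \<in> \<U>. Pow A \<approx> B"
    and X: "s_space X \<K>"
  shows "(\<exists>A \<in> \<U>. \<K> \<approx> A) \<longleftrightarrow> X \<in> \<U>"
proof
  assume "\<exists>A \<in> \<U>. \<K> \<approx> A"
  then obtain A B where "A \<in> \<U>" and A: "\<K> \<approx> A" and B: "B \<in> \<U>" "Pow A \<approx> B"
    using pow by blast
  have "Pow \<K> \<lesssim> Pow A"
  proof -
    obtain f where f: "inj_on f \<K>" "f ` \<K> \<subseteq> A"
      using A by (meson eqpoll_imp_lepoll lepoll_def)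
    then show ?thesis
      unfolding lepoll_def by (intro exI[of _ "image f"]) (auto simp: inj_on_image_Pow)
  qed
  then have "X \<lesssim> B"
    using s_space_points_lepoll[OF X] B(2) by (meson eqpoll_imp_lepoll lepoll_trans)
  then show "X \<in> \<U>" using sub B(1) by blast
next
  assume "X \<in> \<U>"
  then obtain B where B: "B \<in> \<U>" "Pow X \<approx> B" using pow by blast
  have "\<K> \<lesssim> Pow X" using X unfolding s_space_def by (elim conjE subset_imp_lepoll)
  then have "\<K> \<lesssim> B" using B(2) by (meson eqpoll_imp_lepoll lepoll_trans)
  then obtain f where f: "inj_on f \<K>" "f ` \<K> \<subseteq> B" unfolding lepoll_def by blast
  then have "f ` \<K> \<in> \<U>" using sub[OF B(1)] by (simp add: subset_imp_lepoll)
  moreover have "\<K> \<approx> f ` \<K>" using f(1) by (meson eqpoll_sym inj_on_image_eqpoll_self)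
  ultimately show "\<exists>A \<in> \<U>. \<K> \<approx> A" by blast
qed

end

theory Submission
  imports Defs "HOL-Analysis.Function_Topology"
begin

text \<open>
  The duality rests on one idea: an S-space is dual to the semilattice \<open>S(X)\<close> of complements of its
  subbase, with intersection as meet and \<open>X\<close> as top. A multirelation \<open>R\<close> on \<open>X\<close> acts on \<open>S(X)\<close> as the
  monotone operator \<open>m\<^sub>R\<close>, and a relation \<open>T \<subseteq> X \<times> Y\<close> acts backwards as \<open>\<box>\<^sub>T : S(Y) \<rightarrow> S(X)\<close>. Hence
  \<open>X \<mapsto> S(X)\<close>, \<open>T \<mapsto> \<box>\<^sub>T\<close> is a contravariant functor, and a contravariant functor that is full, faithful
  and essentially surjective is a dual equivalence.

  \<^item> \<open>S(X)\<close> is an E-SLata exactly when \<open>X\<close> is an ESLata-space, because the axioms on both sides express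
    the same inclusions between members of \<open>S(X)\<close>: the two conditions that make a pair of mS-spaces an
    SLata-space are the unit and counit form of the adjunction \<open>m\<^sub>I \<stileturn> m\<^sub>D\<close>, so that \<open>P, G, F, H\<close> are the
    operators of \<open>I\<^sub>1, D\<^sub>1, I\<^sub>2, D\<^sub>2\<close>, and the two conditions linking \<open>I\<^sub>1, D\<^sub>1\<close> with \<open>I\<^sub>2, D\<^sub>2\<close> are the
    inequalities linking \<open>P, G\<close> with \<open>F, H\<close> (\<open>is_eslata_iff_is_eslata_space\<close>).

  \<^item> The functor is faithful because each \<open>T(x)\<close> is the intersection of the members \<open>U\<close> of \<open>S(Y)\<close> with
    \<open>x \<in> \<box>\<^sub>T(U)\<close> (\<open>meet_relation_eqI\<close>). It is full because a homomorphism \<open>g : S(Y) \<rightarrow> S(X)\<close> is the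
    box operator of the relation whose value at \<open>x\<close> is the intersection of all \<open>U\<close> with \<open>x \<in> g(U)\<close>;
    compactness of the members of the subbase of \<open>Y\<close> replaces this intersection by a finite one, which
    \<open>g\<close> preserves (\<open>meet_relation_of_meet_hom\<close>).

  \<^item> It is essentially surjective because every E-SLata \<open>A\<close> is isomorphic to \<open>S(X)\<close> for the space \<open>X\<close> of
    irreducible filters of \<open>A\<close>, with \<open>a\<close> corresponding to the set \<open>\<beta>(a)\<close> of irreducible filters that
    contain it (\<open>ex_dual_space\<close>). Compactness and the condition on \<open>Y\<close>-families follow from one
    consequence of Zorn's lemma, \<open>irreducible_extension\<close>, and the condition on intersections of two
    members of the subbase expresses irreducibility of the filters (\<open>irreducible_filter_witness\<close>). A monotone operator \<open>f\<close> on \<open>A\<close> is \<open>m\<^sub>R\<close> for the largest multirelation \<open>R\<close>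
    with \<open>\<beta>(f(a)) \<subseteq> m\<^sub>R(\<beta>(a))\<close> for all \<open>a\<close>.

  An isomorphism \<open>r : A \<cong> S(X)\<close> is the central notion (locale \<open>subbase_representation\<close>). Composition and
  identities of relations are handled only through their box operators, so that even the category laws
  of ESLata-spaces are inherited from homomorphisms (locale \<open>linked_categories\<close>).
\<close>

section \<open>Categories linked by bijections of hom-sets\<close>

text \<open>
  The set \<open>L\<close> consists of witnesses that an object of \<open>D\<close> and an object of \<open>C\<close> correspond; below, a witness
  is an isomorphism between an algebra and the complements of a subbase. An object may have many
  witnesses on either side, and \<open>\<Phi>\<close> depends on the two chosen ones. Such data amount to a fully faithful
  and essentially surjective functor \<open>D \<rightarrow> C\<close>, in a form that is symmetric in \<open>C\<close> and \<open>D\<close> and needs no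
  choice of images. The category laws of \<open>D\<close> are not assumed but reflected by \<open>\<Phi>\<close>.
\<close>

locale linked_categories =
  fixes C :: "('o, 'm) cat" and D :: "('p, 'n) cat"
    and L :: "'l set" and src :: "'l \<Rightarrow> 'p" and tgt :: "'l \<Rightarrow> 'o"
    and \<Phi> :: "'l \<Rightarrow> 'l \<Rightarrow> 'n \<Rightarrow> 'm"
  assumes C_cat: "category C"
    and D_id: "d \<in> Obj D \<Longrightarrow> Idt D d \<in> Hom D d d"
    and D_comp: "\<lbrakk>d \<in> Obj D; d' \<in> Obj D; d'' \<in> Obj D; f \<in> Hom D d d'; g \<in> Hom D d' d''\<rbrakk>
      \<Longrightarrow> Comp D d d' d'' g f \<in> Hom D d d''"
    and src_image: "src ` L = Obj D"
    and tgt_image: "tgt ` L = Obj C"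
    and bij: "\<lbrakk>l \<in> L; l' \<in> L\<rbrakk>
      \<Longrightarrow> bij_betw (\<Phi> l l') (Hom D (src l) (src l')) (Hom C (tgt l) (tgt l'))"
    and \<Phi>_id: "l \<in> L \<Longrightarrow> \<Phi> l l (Idt D (src l)) = Idt C (tgt l)"
    and \<Phi>_comp: "\<lbrakk>l \<in> L; l' \<in> L; l'' \<in> L; f \<in> Hom D (src l) (src l'); g \<in> Hom D (src l') (src l'')\<rbrakk>
      \<Longrightarrow> \<Phi> l l'' (Comp D (src l) (src l') (src l'') g f) =
          Comp C (tgt l) (tgt l') (tgt l'') (\<Phi> l' l'' g) (\<Phi> l l' f)"
begin

lemma src_Obj [simp]: "l \<in> L \<Longrightarrow> src l \<in> Obj D"
  using src_image by blast

lemma tgt_Obj [simp]: "l \<in> L \<Longrightarrow> tgt l \<in> Obj C"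
  using tgt_image by blast

lemma \<Phi>_Hom: "\<lbrakk>l \<in> L; l' \<in> L; f \<in> Hom D (src l) (src l')\<rbrakk> \<Longrightarrow> \<Phi> l l' f \<in> Hom C (tgt l) (tgt l')"
  using bij bij_betwE by blast

lemma \<Phi>_inject:
  "\<lbrakk>l \<in> L; l' \<in> L; f \<in> Hom D (src l) (src l'); g \<in> Hom D (src l) (src l'); \<Phi> l l' f = \<Phi> l l' g\<rbrakk> \<Longrightarrow> f = g"
  using bij[of l l'] by (auto simp: bij_betw_def dest: inj_onD)

lemma C_idL: "\<lbrakk>l \<in> L; l' \<in> L; f \<in> Hom C (tgt l) (tgt l')\<rbrakk>
    \<Longrightarrow> Comp C (tgt l) (tgt l') (tgt l') (Idt C (tgt l')) f = f"
  using C_cat tgt_Obj unfolding category_def by blast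

lemma C_idR: "\<lbrakk>l \<in> L; l' \<in> L; f \<in> Hom C (tgt l) (tgt l')\<rbrakk>
    \<Longrightarrow> Comp C (tgt l) (tgt l) (tgt l') f (Idt C (tgt l)) = f"
  using C_cat tgt_Obj unfolding category_def by blast

lemma C_assoc: "\<lbrakk>l \<in> L; l' \<in> L; l'' \<in> L; l''' \<in> L; f \<in> Hom C (tgt l) (tgt l');
      g \<in> Hom C (tgt l') (tgt l''); h \<in> Hom C (tgt l'') (tgt l''')\<rbrakk>
    \<Longrightarrow> Comp C (tgt l) (tgt l') (tgt l''') (Comp C (tgt l') (tgt l'') (tgt l''') h g) f =
        Comp C (tgt l) (tgt l'') (tgt l''') h (Comp C (tgt l) (tgt l') (tgt l'') g f)"
  using C_cat tgt_Obj unfolding category_def by blast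

lemma D_idL:
  assumes "l \<in> L" "l' \<in> L" "f \<in> Hom D (src l) (src l')"
  shows "Comp D (src l) (src l') (src l') (Idt D (src l')) f = f"
  using assms by (intro \<Phi>_inject[of l l']) (simp_all add: D_id D_comp \<Phi>_comp \<Phi>_id \<Phi>_Hom C_idL)

lemma D_idR:
  assumes "l \<in> L" "l' \<in> L" "f \<in> Hom D (src l) (src l')"
  shows "Comp D (src l) (src l) (src l') f (Idt D (src l)) = f"
  using assms by (intro \<Phi>_inject[of l l']) (simp_all add: D_id D_comp \<Phi>_comp \<Phi>_id \<Phi>_Hom C_idR)

lemma D_assoc:
  assumes l: "l \<in> L" "l' \<in> L" "l'' \<in> L" "l''' \<in> L" 
    and f: "f \<in> Hom D (src l) (src l')" "g \<in> Hom D (src l') (src l'')" "h \<in> Hom D (src l'') (src l''')"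
  shows "Comp D (src l) (src l') (src l''') (Comp D (src l') (src l'') (src l''') h g) f =
         Comp D (src l) (src l'') (src l''') h (Comp D (src l) (src l') (src l'') g f)"
proof (rule \<Phi>_inject[OF l(1,4)])
  note [simp] = l f
  have hg: "Comp D (src l') (src l'') (src l''') h g \<in> Hom D (src l') (src l''')"
    by (rule D_comp; simp)
  have gf: "Comp D (src l) (src l') (src l'') g f \<in> Hom D (src l) (src l'')"
    by (rule D_comp; simp)
  show "Comp D (src l) (src l') (src l''') (Comp D (src l') (src l'') (src l''') h g) f
      \<in> Hom D (src l) (src l''')"
    using hg by (intro D_comp) simp_all
  show "Comp D (src l) (src l'') (src l''') h (Comp D (src l) (src l') (src l'') g f)
      \<in> Hom D (src l) (src l''')"
    using gf by (intro D_comp) simp_all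
  show "\<Phi> l l''' (Comp D (src l) (src l') (src l''') (Comp D (src l') (src l'') (src l''') h g) f) =
      \<Phi> l l''' (Comp D (src l) (src l'') (src l''') h (Comp D (src l) (src l') (src l'') g f))"
    unfolding \<Phi>_comp[OF l(1,2,4) f(1) hg] \<Phi>_comp[OF l(2,3,4) f(2,3)]
      \<Phi>_comp[OF l(1,3,4) gf f(3)] \<Phi>_comp[OF l(1,2,3) f(1,2)]
    by (rule C_assoc[OF l]) (rule \<Phi>_Hom; simp)+
qed

lemma D_cat: "category D"
  unfolding category_def src_image[symmetric]
proof (intro conjI ballI; (elim imageE)?; hypsubst)
qed (simp_all add: D_id D_comp D_idL D_idR D_assoc)

text \<open>
  The object parts of the two functors of the equivalence come from choosing one link at every object.
\<close>

definition link_at_tgt :: "'o \<Rightarrow> 'l" where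
  "link_at_tgt c = (SOME l. l \<in> L \<and> tgt l = c)"

definition link_at_src :: "'p \<Rightarrow> 'l" where
  "link_at_src d = (SOME l. l \<in> L \<and> src l = d)"

lemma link_at_tgt: assumes "c \<in> Obj C" shows "link_at_tgt c \<in> L" "tgt (link_at_tgt c) = c"
proof -
  have "\<exists>l. l \<in> L \<and> tgt l = c" using assms tgt_image by (metis imageE)
  from someI_ex[OF this] show "link_at_tgt c \<in> L" "tgt (link_at_tgt c) = c"
    unfolding link_at_tgt_def by blast+
qed

lemma link_at_src: assumes "d \<in> Obj D" shows "link_at_src d \<in> L" "src (link_at_src d) = d"
proof -
  have "\<exists>l. l \<in> L \<and> src l = d" using assms src_image by (metis imageE)
  from someI_ex[OF this] show "link_at_src d \<in> L" "src (link_at_src d) = d"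
    unfolding link_at_src_def by blast+
qed

definition \<Psi> :: "'l \<Rightarrow> 'l \<Rightarrow> 'm \<Rightarrow> 'n" where
  "\<Psi> l l' = inv_into (Hom D (src l) (src l')) (\<Phi> l l')"

lemma \<Psi>:
  assumes "l \<in> L" "l' \<in> L" "h \<in> Hom C (tgt l) (tgt l')"
  shows "\<Psi> l l' h \<in> Hom D (src l) (src l')" "\<Phi> l l' (\<Psi> l l' h) = h"
  using bij[OF assms(1,2)] assms(3) unfolding \<Psi>_def bij_betw_def
  by (auto intro: inv_into_into f_inv_into_f)

lemma \<Psi>_eq:
  assumes "l \<in> L" "l' \<in> L" "f \<in> Hom D (src l) (src l')" "\<Phi> l l' f = h"
  shows "\<Psi> l l' h = f"
  using assms by (metis \<Phi>_Hom \<Phi>_inject \<Psi>)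


text \<open>
  Two objects of \<open>C\<close> linked to the same object of \<open>D\<close> are isomorphic, by the image of its identity. All
  components of the natural isomorphisms of the equivalence are of this form.
\<close>

lemma iso_tgt:
  assumes l: "l \<in> L" "l' \<in> L" and eq: "src l' = src l"
  shows "is_iso C (tgt l) (tgt l') (\<Phi> l l' (Idt D (src l)))"
proof -
  define i where "i = Idt D (src l)"
  have i: "i \<in> Hom D (src l) (src l)" and ii: "Comp D (src l) (src l) (src l) i i = i"
    using l D_idL[of l l i] unfolding i_def by (simp_all add: D_id)
  have "\<Phi> l l i = Idt C (tgt l)" "\<Phi> l' l' i = Idt C (tgt l')"
    using \<Phi>_id[of l] \<Phi>_id[of l'] l eq unfolding i_def by simp_all
  moreover have "Comp C (tgt l) (tgt l') (tgt l) (\<Phi> l' l i) (\<Phi> l l' i) = \<Phi> l l i"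
    using \<Phi>_comp[of l l' l i i] l i ii eq by simp
  moreover have "Comp C (tgt l') (tgt l) (tgt l') (\<Phi> l l' i) (\<Phi> l' l i) = \<Phi> l' l' i"
    using \<Phi>_comp[of l' l l' i i] l i ii eq by simp
  moreover have "\<Phi> l l' i \<in> Hom C (tgt l) (tgt l')" "\<Phi> l' l i \<in> Hom C (tgt l') (tgt l)"
    using \<Phi>_Hom[of l l' i] \<Phi>_Hom[of l' l i] l i eq by simp_all
  ultimately show ?thesis
    unfolding is_iso_def i_def[symmetric] by auto
qed

lemma \<Psi>_id: "l \<in> L \<Longrightarrow> \<Psi> l l (Idt C (tgt l)) = Idt D (src l)"
  by (intro \<Psi>_eq) (simp_all add: D_id \<Phi>_id)

lemma \<Psi>_comp:
  assumes "l \<in> L" "l' \<in> L" "l'' \<in> L" "f \<in> Hom C (tgt l) (tgt l')" "g \<in> Hom C (tgt l') (tgt l'')"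
  shows "\<Psi> l l'' (Comp C (tgt l) (tgt l') (tgt l'') g f) =
          Comp D (src l) (src l') (src l'') (\<Psi> l' l'' g) (\<Psi> l l' f)"
  using assms by (intro \<Psi>_eq) (simp_all add: \<Psi> D_comp \<Phi>_comp)

text \<open>
  Since the data are symmetric, every statement about \<open>C\<close> has a counterpart about \<open>D\<close>.
\<close>

lemma inverse_linked: "linked_categories D C L tgt src \<Psi>"
proof
  show "bij_betw (\<Psi> l l') (Hom C (tgt l) (tgt l')) (Hom D (src l) (src l'))" if "l \<in> L" "l' \<in> L" for l l'
    unfolding \<Psi>_def by (rule bij_betw_inv_into) (rule bij[OF that])
  show "Idt C c \<in> Hom C c c" if "c \<in> Obj C" for c
    using C_cat that unfolding category_def by blast
  show "Comp C c c' c'' g f \<in> Hom C c c''"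
    if "c \<in> Obj C" "c' \<in> Obj C" "c'' \<in> Obj C" "f \<in> Hom C c c'" "g \<in> Hom C c' c''" for c c' c'' f g
    using C_cat that unfolding category_def by blast
qed (simp_all add: D_cat src_image tgt_image \<Psi>_id \<Psi>_comp)

lemma functor_tgt:
  assumes l: "\<And>d. d \<in> Obj D \<Longrightarrow> l d \<in> L \<and> src (l d) = d"
  shows "is_functor D C (\<lambda>d. tgt (l d)) (\<lambda>d d'. \<Phi> (l d) (l d'))"
  unfolding is_functor_def
proof (intro conjI ballI)
  fix d d' d'' f g
  assume d: "d \<in> Obj D" "d' \<in> Obj D" "d'' \<in> Obj D" and "f \<in> Hom D d d'" "g \<in> Hom D d' d''"
  then show "\<Phi> (l d) (l d'') (Comp D d d' d'' g f) =
    Comp C (tgt (l d)) (tgt (l d')) (tgt (l d'')) (\<Phi> (l d') (l d'') g) (\<Phi> (l d) (l d') f)"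
    using \<Phi>_comp[of "l d" "l d'" "l d''" f g] by (simp add: l)
next
  fix d assume "d \<in> Obj D"
  then show "\<Phi> (l d) (l d) (Idt D d) = Idt C (tgt (l d))" using \<Phi>_id[of "l d"] l by simp
qed (use l in \<open>auto intro: \<Phi>_Hom\<close>)

text \<open>
  Going from \<open>C\<close> to \<open>D\<close> along the links \<open>l\<close> and back along the links \<open>k\<close> is naturally isomorphic to the
  identity. Naturality holds because, for \<open>f = \<Phi> (l c) (l c') g\<close>, both paths around the square are the
  mixed image \<open>\<Phi> (l c) (k c') g\<close>.
\<close>

lemma nat_iso_tgt:
  assumes l: "\<And>c. c \<in> Obj C \<Longrightarrow> l c \<in> L \<and> tgt (l c) = c"
    and k: "\<And>c. c \<in> Obj C \<Longrightarrow> k c \<in> L \<and> src (k c) = src (l c)"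
  shows "nat_isomorphic C C (\<lambda>c. c) (\<lambda>c c' f. f)
    (\<lambda>c. tgt (k c)) (\<lambda>c c' f. \<Phi> (k c) (k c') (\<Psi> (l c) (l c') f))"
  unfolding nat_isomorphic_def
proof (intro exI[of _ "\<lambda>c. \<Phi> (l c) (k c) (Idt D (src (l c)))"] conjI ballI)
  fix c assume "c \<in> Obj C"
  then show "is_iso C c (tgt (k c)) (\<Phi> (l c) (k c) (Idt D (src (l c))))"
    using iso_tgt[of "l c" "k c"] l k by simp
next
  fix c c' f assume c: "c \<in> Obj C" "c' \<in> Obj C" and f: "f \<in> Hom C c c'"
  note [simp] = l[OF c(1)] l[OF c(2)] k[OF c(1)] k[OF c(2)]
  define g where "g = \<Psi> (l c) (l c') f"
  have g: "g \<in> Hom D (src (l c)) (src (l c'))" and fg: "f = \<Phi> (l c) (l c') g"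
    unfolding g_def using \<Psi>[of "l c" "l c'" f] f by simp_all
  have "Comp C c c' (tgt (k c')) (\<Phi> (l c') (k c') (Idt D (src (l c')))) f = \<Phi> (l c) (k c') g"
    using \<Phi>_comp[of "l c" "l c'" "k c'" g "Idt D (src (l c'))"] D_idL[of "l c" "l c'" g] g
    by (simp add: fg D_id)
  moreover have "Comp C c (tgt (k c)) (tgt (k c')) (\<Phi> (k c) (k c') g) (\<Phi> (l c) (k c) (Idt D (src (l c))))
      = \<Phi> (l c) (k c') g"
    using \<Phi>_comp[of "l c" "k c" "k c'" "Idt D (src (l c))" g] D_idR[of "l c" "l c'" g] g
    by (simp add: D_id)
  ultimately show "Comp C c c' (tgt (k c')) (\<Phi> (l c') (k c') (Idt D (src (l c')))) f =
     Comp C c (tgt (k c)) (tgt (k c')) (\<Phi> (k c) (k c') (\<Psi> (l c) (l c') f)) (\<Phi> (l c) (k c) (Idt D (src (l c))))"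
    by (simp add: g_def)
qed

lemma equivalence: "equivalent_cats C D"
  unfolding equivalent_cats_def
proof (intro conjI exI)
  interpret swap: linked_categories D C L tgt src \<Psi> by (rule inverse_linked)
  have swap_swap: "swap.\<Psi> l l' f = \<Phi> l l' f" if "l \<in> L" "l' \<in> L" "f \<in> Hom D (src l) (src l')" for l l' f
    using that by (intro swap.\<Psi>_eq) (simp_all add: \<Phi>_Hom \<Psi>_eq)
  show "category C" "category D" by (fact C_cat D_cat)+
  show "is_functor C D (\<lambda>c. src (link_at_tgt c)) (\<lambda>c c'. \<Psi> (link_at_tgt c) (link_at_tgt c'))"
    by (rule swap.functor_tgt) (simp add: link_at_tgt)
  show "is_functor D C (\<lambda>d. tgt (link_at_src d)) (\<lambda>d d'. \<Phi> (link_at_src d) (link_at_src d'))"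
    by (rule functor_tgt) (simp add: link_at_src)
  show "nat_isomorphic C C (\<lambda>c. c) (\<lambda>c c' f. f) (\<lambda>c. tgt (link_at_src (src (link_at_tgt c))))
    (\<lambda>c c' f. \<Phi> (link_at_src (src (link_at_tgt c))) (link_at_src (src (link_at_tgt c')))
      (\<Psi> (link_at_tgt c) (link_at_tgt c') f))"
    by (rule nat_iso_tgt) (simp_all add: link_at_tgt link_at_src)
  have "nat_isomorphic D D (\<lambda>d. d) (\<lambda>d d' f. f) (\<lambda>d. src (link_at_tgt (tgt (link_at_src d))))
    (\<lambda>d d' f. \<Psi> (link_at_tgt (tgt (link_at_src d))) (link_at_tgt (tgt (link_at_src d')))
      (swap.\<Psi> (link_at_src d) (link_at_src d') f))"
    by (rule swap.nat_iso_tgt) (simp_all add: link_at_tgt link_at_src)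
  then show "nat_isomorphic D D (\<lambda>d. d) (\<lambda>d d' f. f) (\<lambda>d. src (link_at_tgt (tgt (link_at_src d))))
    (\<lambda>d d' f. \<Psi> (link_at_tgt (tgt (link_at_src d))) (link_at_tgt (tgt (link_at_src d')))
      (\<Phi> (link_at_src d) (link_at_src d') f))"
    unfolding nat_isomorphic_def by (simp add: swap_swap link_at_src)
qed

end

section \<open>Subbases of S-spaces\<close>

lemma topspace_subbase_topology [simp]: "topspace (subbase_topology X \<K>) = X"
  by (simp add: subbase_topology_def)

lemma openin_subbase_member:
  assumes "U \<in> \<K>" "U \<subseteq> X"
  shows "openin (subbase_topology X \<K>) U"
proof -
  have "(finite intersection_of (\<lambda>U. U \<in> \<K>)) U"
    using assms(1) by (simp add: finite_intersection_of_inc)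
  then have "(finite intersection_of (\<lambda>U. U \<in> \<K>) relative_to X) U"
    using assms(2) by (rule relative_to_subset_inc[rotated])
  then show ?thesis
    unfolding subbase_topology_def openin_subbase by (rule arbitrary_union_of_inc)
qed

lemma subbase_neighbourhood:
  assumes "openin (subbase_topology X \<K>) U" and "x \<in> U"
  obtains \<F> where "finite \<F>" "\<F> \<subseteq> \<K>" "x \<in> \<Inter>\<F>" "X \<inter> \<Inter>\<F> \<subseteq> U"
proof -
  obtain \<B> where \<B>: "\<B> \<subseteq> Collect (finite intersection_of (\<lambda>U. U \<in> \<K>) relative_to X)" "\<Union>\<B> = U"
    using assms(1)[unfolded subbase_topology_def openin_subbase] unfolding union_of_def by auto
  then obtain B where B: "B \<in> \<B>" "x \<in> B" using assms(2) by blast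
  then obtain \<F> where "finite \<F>" "\<F> \<subseteq> \<K>" "B = X \<inter> \<Inter>\<F>"
    using subsetD[OF \<B>(1) B(1)] unfolding relative_to_def intersection_of_def by auto
  then show thesis using that B \<B>(2) by blast
qed

text \<open>
  The specialization order can be tested on the subbase. Phrased with complements, it says that the
  closure of a point is the intersection of the members of \<open>S(X)\<close> containing it.
\<close>

lemma closure_of_point_subbase:
  assumes "x \<in> X" and "\<K> \<subseteq> Pow X"
  shows "y \<in> subbase_topology X \<K> closure_of {x} \<longleftrightarrow> y \<in> X \<and> (\<forall>U \<in> co_subbase X \<K>. x \<in> U \<longrightarrow> y \<in> U)"
proof
  assume y: "y \<in> subbase_topology X \<K> closure_of {x}"
  show "y \<in> X \<and> (\<forall>U \<in> co_subbase X \<K>. x \<in> U \<longrightarrow> y \<in> U)"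
  proof (intro conjI ballI impI)
    show "y \<in> X" using y by (simp add: in_closure_of)
    fix U assume U: "U \<in> co_subbase X \<K>" and "x \<in> U"
    then obtain V where V: "V \<in> \<K>" "U = X - V" unfolding co_subbase_def by blast
    have "openin (subbase_topology X \<K>) V"
      using V assms(2) by (auto intro: openin_subbase_member)
    then have "y \<notin> V"
      using y \<open>x \<in> U\<close> V(2) by (auto simp: in_closure_of)
    then show "y \<in> U" using V(2) \<open>y \<in> X\<close> by simp
  qed
next
  assume y: "y \<in> X \<and> (\<forall>U \<in> co_subbase X \<K>. x \<in> U \<longrightarrow> y \<in> U)"
  have "x \<in> T" if T: "openin (subbase_topology X \<K>) T" "y \<in> T" for T
  proof -
    obtain \<F> where "finite \<F>" and \<F>: "\<F> \<subseteq> \<K>" "y \<in> \<Inter>\<F>" "X \<inter> \<Inter>\<F> \<subseteq> T"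
      by (rule subbase_neighbourhood[OF T])
    have "x \<in> V" if V: "V \<in> \<F>" for V
    proof (rule ccontr)
      assume "x \<notin> V"
      then have "x \<in> X - V" using assms(1) by simp
      moreover have "X - V \<in> co_subbase X \<K>" using V \<F>(1) unfolding co_subbase_def by auto
      ultimately have "y \<in> X - V" using y by (metis (no_types))
      then show False using \<F>(2) V by simp
    qed
    then show ?thesis using \<F>(3) assms(1) by blast
  qed
  then show "y \<in> subbase_topology X \<K> closure_of {x}"
    using y by (auto simp: in_closure_of)
qed

lemma
  assumes "s_space X \<K>"
  shows s_space_subset: "\<K> \<subseteq> Pow X"
    and s_space_compactin: "\<forall>U \<in> \<K>. compactin (subbase_topology X \<K>) U"
    and s_space_Un: "\<forall>U \<in> \<K>. \<forall>V \<in> \<K>. U \<union> V \<in> \<K>"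
    and s_space_empty: "{} \<in> \<K>"
  using assms unfolding s_space_def by - (elim conjE, assumption)+

lemma co_subbase_subset: "U \<in> co_subbase X \<K> \<Longrightarrow> U \<subseteq> X"
  unfolding co_subbase_def by blast

lemma top_in_co_subbase: "s_space X \<K> \<Longrightarrow> X \<in> co_subbase X \<K>"
  using s_space_empty[of X \<K>] unfolding co_subbase_def by auto

lemma Int_in_co_subbase:
  assumes "s_space X \<K>" "U \<in> co_subbase X \<K>" "V \<in> co_subbase X \<K>"
  shows "U \<inter> V \<in> co_subbase X \<K>"
proof -
  obtain U' V' where *: "U' \<in> \<K>" "V' \<in> \<K>" "U = X - U'" "V = X - V'"
    using assms(2,3) unfolding co_subbase_def by blast
  have "U' \<union> V' \<in> \<K>" using s_space_Un[OF assms(1)] *(1,2) by blast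
  moreover have "U \<inter> V = X - (U' \<union> V')" using * by blast
  ultimately show ?thesis unfolding co_subbase_def by blast
qed

lemma Inter_in_co_subbase:
  assumes "s_space X \<K>" "finite \<F>" "\<F> \<subseteq> co_subbase X \<K>"
  shows "X \<inter> \<Inter>\<F> \<in> co_subbase X \<K>"
  using assms(2,3)
proof (induction \<F>)
  case empty
  then show ?case using top_in_co_subbase[OF assms(1)] by simp
next
  case (insert U \<F>)
  then have "U \<inter> (X \<inter> \<Inter>\<F>) \<in> co_subbase X \<K>"
    using Int_in_co_subbase[OF assms(1), of U "X \<inter> \<Inter>\<F>"] by simp
  moreover have "U \<inter> (X \<inter> \<Inter>\<F>) = X \<inter> \<Inter>(insert U \<F>)" by auto
  ultimately show ?case by simp
qed

lemma co_subbase_eqpoll: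
  assumes "s_space X \<K>"
  shows "co_subbase X \<K> \<approx> \<K>"
proof -
  have "bij_betw (\<lambda>U. X - U) \<K> (co_subbase X \<K>)"
    using s_space_subset[OF assms] unfolding bij_betw_def co_subbase_def by (auto intro!: inj_onI)
  then show ?thesis unfolding eqpoll_def by (meson eqpoll_def eqpoll_sym)
qed

text \<open>
  Compactness of the members of the subbase, read through complements: \<open>X - U\<close> is compact and is covered
  by the complements of the members of \<open>\<F>\<close>. The intersection with \<open>X\<close> matters for the empty family.
\<close>

lemma compact_Inter_subset:
  assumes X: "s_space X \<K>" and \<F>: "\<F> \<subseteq> co_subbase X \<K>" and U: "U \<in> co_subbase X \<K>"
    and sub: "X \<inter> \<Inter>\<F> \<subseteq> U"
  obtains \<G> where "finite \<G>" "\<G> \<subseteq> \<F>" "X \<inter> \<Inter>\<G> \<subseteq> U"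
proof -
  obtain U' where U': "U' \<in> \<K>" "U = X - U'" using U unfolding co_subbase_def by blast
  have comp: "compactin (subbase_topology X \<K>) U'"
    using s_space_compactin[OF X] U'(1) by blast
  have U'X: "U' \<subseteq> X" using s_space_subset[OF X] U'(1) by blast
  have opens: "openin (subbase_topology X \<K>) (X - V)" if V: "V \<in> \<F>" for V
  proof -
    obtain V' where V': "V' \<in> \<K>" "V = X - V'" using V \<F> unfolding co_subbase_def by blast
    moreover have "V' \<subseteq> X" using s_space_subset[OF X] V'(1) by blast
    ultimately show ?thesis by (simp add: double_diff openin_subbase_member)
  qed
  have cover: "U' \<subseteq> \<Union>((\<lambda>V. X - V) ` \<F>)" using U'X U'(2) sub by blast
  have "\<exists>\<G>. finite \<G> \<and> \<G> \<subseteq> (\<lambda>V. X - V) ` \<F> \<and> U' \<subseteq> \<Union>\<G>"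
    using comp cover opens unfolding compactin_def by (metis (no_types, lifting) imageE)
  then obtain \<G> where \<G>: "finite \<G>" "\<G> \<subseteq> (\<lambda>V. X - V) ` \<F>" "U' \<subseteq> \<Union>\<G>" by blast
  then obtain \<H> where \<H>: "\<H> \<subseteq> \<F>" "finite \<H>" "\<G> = (\<lambda>V. X - V) ` \<H>"
    using finite_subset_image[OF \<G>(1,2)] by blast
  have "X \<inter> \<Inter>\<H> \<subseteq> U" using \<G>(3) \<H>(3) U'(2) by blast
  then show thesis using that \<H> by blast
qed

section \<open>Meet-relations and their box operators\<close>

text \<open>
  A meet-relation is recovered from its box operator.
\<close>

lemma meet_relation_eq_Inter_box:
  assumes "meet_relation X \<K> Y \<L> T" "x \<in> X"
  shows "T `` {x} = \<Inter>{U \<in> co_subbase Y \<L>. x \<in> box_op X T U}"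
proof -
  have "T `` {x} = \<Inter>{U \<in> co_subbase Y \<L>. T `` {x} \<subseteq> U}"
    using assms unfolding meet_relation_def by blast
  also have "{U \<in> co_subbase Y \<L>. T `` {x} \<subseteq> U} = {U \<in> co_subbase Y \<L>. x \<in> box_op X T U}"
    using assms(2) by (auto simp: box_op_def)
  finally show ?thesis .
qed

lemma meet_relation_eqI:
  assumes T: "meet_relation X \<K> Y \<L> T" and T': "meet_relation X \<K> Y \<L> T'"
    and eq: "\<And>U. U \<in> co_subbase Y \<L> \<Longrightarrow> box_op X T U = box_op X T' U"
  shows "T = T'"
proof -
  have "T `` {x} = T' `` {x}" for x
  proof (cases "x \<in> X")
    case True
    have "{U \<in> co_subbase Y \<L>. x \<in> box_op X T U} = {U \<in> co_subbase Y \<L>. x \<in> box_op X T' U}"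
      using eq by blast
    then show ?thesis
      unfolding meet_relation_eq_Inter_box[OF T True] meet_relation_eq_Inter_box[OF T' True] by simp
  next
    case False
    have "T \<subseteq> X \<times> Y" "T' \<subseteq> X \<times> Y" using T T' unfolding meet_relation_def by blast+
    with False have "T `` {x} = {}" "T' `` {x} = {}" by blast+
    then show ?thesis by simp
  qed
  then show ?thesis by (auto simp: set_eq_iff)
qed

text \<open>
  Fullness. The relation must be \<open>T(x) = \<Inter>{U. x \<in> g U}\<close>, by \<open>meet_relation_eq_Inter_box\<close>. If this
  intersection lies in \<open>U\<close>, then by compactness so does the intersection of finitely many members; \<open>g\<close>
  preserves finite meets, so \<open>x\<close> lies in \<open>g\<close> of this finite intersection and therefore in \<open>g U\<close>.
\<close>

lemma meet_relation_of_meet_hom: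
  assumes Y: "s_space Y \<L>"
    and g: "\<And>U. U \<in> co_subbase Y \<L> \<Longrightarrow> g U \<in> co_subbase X \<K>"
    and g_top: "g Y = X"
    and g_Int: "\<And>U V. \<lbrakk>U \<in> co_subbase Y \<L>; V \<in> co_subbase Y \<L>\<rbrakk> \<Longrightarrow> g (U \<inter> V) = g U \<inter> g V"
  obtains T where "meet_relation X \<K> Y \<L> T"
    and "\<And>U. U \<in> co_subbase Y \<L> \<Longrightarrow> box_op X T U = g U"
proof
  define T where "T = {(x, y) \<in> X \<times> Y. \<forall>U \<in> co_subbase Y \<L>. x \<in> g U \<longrightarrow> y \<in> U}"
  have T_image: "T `` {x} = Y \<inter> \<Inter>{U \<in> co_subbase Y \<L>. x \<in> g U}" if "x \<in> X" for x
    using that unfolding T_def by auto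
  have g_mono: "g U \<subseteq> g V" if "U \<in> co_subbase Y \<L>" "V \<in> co_subbase Y \<L>" "U \<subseteq> V" for U V
    using g_Int[OF that(1,2)] that(3) by (metis inf.absorb_iff1 inf.orderI)
  have g_Inter: "x \<in> g (Y \<inter> \<Inter>\<F>)"
    if "finite \<F>" "\<F> \<subseteq> co_subbase Y \<L>" "\<forall>U \<in> \<F>. x \<in> g U" "x \<in> X" for \<F> x
    using that
  proof (induction \<F>)
    case empty
    then show ?case using g_top by simp
  next
    case (insert U \<F>)
    then have "x \<in> g U \<inter> g (Y \<inter> \<Inter>\<F>)" by simp
    also have "\<dots> = g (U \<inter> (Y \<inter> \<Inter>\<F>))"
      using insert by (intro g_Int[symmetric] Inter_in_co_subbase[OF Y]) auto
    also have "U \<inter> (Y \<inter> \<Inter>\<F>) = Y \<inter> \<Inter>(insert U \<F>)" by auto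
    finally show ?case .
  qed
  show box: "box_op X T U = g U" if U: "U \<in> co_subbase Y \<L>" for U
  proof
    show "g U \<subseteq> box_op X T U"
    proof
      fix x assume "x \<in> g U"
      moreover from this have "x \<in> X" using co_subbase_subset[OF g[OF U]] by blast
      ultimately show "x \<in> box_op X T U" using U unfolding box_op_def T_def by auto
    qed
    show "box_op X T U \<subseteq> g U"
    proof
      fix x assume "x \<in> box_op X T U"
      then have x: "x \<in> X" and "Y \<inter> \<Inter>{V \<in> co_subbase Y \<L>. x \<in> g V} \<subseteq> U"
        using T_image[of x] unfolding box_op_def by blast+
      then obtain \<G> where \<G>: "finite \<G>" "\<G> \<subseteq> {V \<in> co_subbase Y \<L>. x \<in> g V}" "Y \<inter> \<Inter>\<G> \<subseteq> U"
        using compact_Inter_subset[OF Y _ U, of "{V \<in> co_subbase Y \<L>. x \<in> g V}"] by blast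
      have "x \<in> g (Y \<inter> \<Inter>\<G>)" using \<G> x by (intro g_Inter) auto
      also have "\<dots> \<subseteq> g U" using \<G> U by (intro g_mono Inter_in_co_subbase[OF Y]) auto
      finally show "x \<in> g U" .
    qed
  qed
  show "meet_relation X \<K> Y \<L> T"
    unfolding meet_relation_def
  proof (intro conjI ballI)
    show "T \<subseteq> X \<times> Y" unfolding T_def by blast
    show "box_op X T U \<in> co_subbase X \<K>" if "U \<in> co_subbase Y \<L>" for U
      using box[OF that] g[OF that] by simp
    fix x assume x: "x \<in> X"
    have "{U \<in> co_subbase Y \<L>. T `` {x} \<subseteq> U} = {U \<in> co_subbase Y \<L>. x \<in> g U}"
      using box x by (auto simp: box_op_def)
    moreover have "\<Inter>{U \<in> co_subbase Y \<L>. x \<in> g U} \<subseteq> Y"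
      using top_in_co_subbase[OF Y] g_top x by blast
    ultimately show "T `` {x} = \<Inter>{U \<in> co_subbase Y \<L>. T `` {x} \<subseteq> U}"
      using T_image[OF x] by auto
  qed
qed

lemma box_op_dual_specialization:
  assumes "s_space (points \<X>) (subbase \<X>)" "U \<in> co_subbase (points \<X>) (subbase \<X>)"
  shows "box_op (points \<X>) (dual_specialization \<X>) U = U"
  using closure_of_point_subbase[of _ "points \<X>" "subbase \<X>"] s_space_subset[OF assms(1)] assms(2)
    co_subbase_subset[OF assms(2)]
  unfolding box_op_def dual_specialization_def by blast

lemma meet_relation_dual_specialization:
  assumes X: "s_space (points \<X>) (subbase \<X>)"
  shows "meet_relation (points \<X>) (subbase \<X>) (points \<X>) (subbase \<X>) (dual_specialization \<X>)"
  unfolding meet_relation_def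
proof (intro conjI ballI)
  let ?S = "co_subbase (points \<X>) (subbase \<X>)"
  show "dual_specialization \<X> \<subseteq> points \<X> \<times> points \<X>"
    unfolding dual_specialization_def by blast
  show "box_op (points \<X>) (dual_specialization \<X>) U \<in> ?S" if "U \<in> ?S" for U
    using that by (simp add: box_op_dual_specialization[OF X])
  fix x assume x: "x \<in> points \<X>"
  have e1: "{U \<in> ?S. dual_specialization \<X> `` {x} \<subseteq> U} = {U \<in> ?S. x \<in> U}"
    using box_op_dual_specialization[OF X] x by (auto simp: box_op_def)
  have e2: "dual_specialization \<X> `` {x} = points \<X> \<inter> \<Inter>{U \<in> ?S. x \<in> U}"
    using closure_of_point_subbase[OF x s_space_subset[OF X]] x
    unfolding dual_specialization_def by auto
  have e3: "\<Inter>{U \<in> ?S. x \<in> U} \<subseteq> points \<X>"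
    using top_in_co_subbase[OF X] x by blast
  show "dual_specialization \<X> `` {x} = \<Inter>{U \<in> ?S. dual_specialization \<X> `` {x} \<subseteq> U}"
    unfolding e1 unfolding e2 by (rule Int_absorb1[OF e3])
qed

text \<open>
  \<open>T * R\<close> is the closure of the relational composite under intersections of members of \<open>S(Z)\<close>, so both
  have the same upper bounds in \<open>S(Z)\<close>; consequently box operators compose contravariantly.
\<close>

lemma star_comp_subset_iff:
  assumes T: "T \<subseteq> points \<Y> \<times> points \<Z>" and U: "U \<in> co_subbase (points \<Z>) (subbase \<Z>)"
    and x: "x \<in> points \<X>"
  shows "star_comp \<X> \<Z> T R `` {x} \<subseteq> U \<longleftrightarrow> (R O T) `` {x} \<subseteq> U"
proof
  assume "star_comp \<X> \<Z> T R `` {x} \<subseteq> U"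
  moreover have "(R O T) `` {x} \<subseteq> star_comp \<X> \<Z> T R `` {x}"
    using x T unfolding star_comp_def by blast
  ultimately show "(R O T) `` {x} \<subseteq> U" by blast
next
  assume "(R O T) `` {x} \<subseteq> U"
  then show "star_comp \<X> \<Z> T R `` {x} \<subseteq> U"
    using U unfolding star_comp_def by blast
qed

lemma box_op_star_comp:
  assumes R: "R \<subseteq> points \<X> \<times> points \<Y>" and T: "T \<subseteq> points \<Y> \<times> points \<Z>"
    and U: "U \<in> co_subbase (points \<Z>) (subbase \<Z>)"
  shows "box_op (points \<X>) (star_comp \<X> \<Z> T R) U = box_op (points \<X>) R (box_op (points \<Y>) T U)"
proof -
  have "(R O T) `` {x} \<subseteq> U \<longleftrightarrow> R `` {x} \<subseteq> box_op (points \<Y>) T U" for x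
    using R unfolding box_op_def by blast
  then show ?thesis
    unfolding box_op_def[of "points \<X>"]
    by (intro Collect_cong conj_cong refl) (simp only: star_comp_subset_iff[OF T U])
qed

lemma meet_relation_star_comp:
  assumes R: "meet_relation (points \<X>) (subbase \<X>) (points \<Y>) (subbase \<Y>) R"
    and T: "meet_relation (points \<Y>) (subbase \<Y>) (points \<Z>) (subbase \<Z>) T"
    and Z: "s_space (points \<Z>) (subbase \<Z>)"
  shows "meet_relation (points \<X>) (subbase \<X>) (points \<Z>) (subbase \<Z>) (star_comp \<X> \<Z> T R)"
  unfolding meet_relation_def
proof (intro conjI ballI)
  let ?S = "co_subbase (points \<Z>) (subbase \<Z>)"
  have sub: "R \<subseteq> points \<X> \<times> points \<Y>" "T \<subseteq> points \<Y> \<times> points \<Z>"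
    using R T unfolding meet_relation_def by blast+
  show "star_comp \<X> \<Z> T R \<subseteq> points \<X> \<times> points \<Z>" unfolding star_comp_def by blast
  show "box_op (points \<X>) (star_comp \<X> \<Z> T R) U \<in> co_subbase (points \<X>) (subbase \<X>)" if "U \<in> ?S" for U
    using R T that unfolding box_op_star_comp[OF sub that] meet_relation_def by blast
  fix x assume x: "x \<in> points \<X>"
  have e1: "{U \<in> ?S. star_comp \<X> \<Z> T R `` {x} \<subseteq> U} = {U \<in> ?S. (R O T) `` {x} \<subseteq> U}"
    by (intro Collect_cong conj_cong refl) (simp only: star_comp_subset_iff[OF sub(2) _ x])
  have e2: "star_comp \<X> \<Z> T R `` {x} = points \<Z> \<inter> \<Inter>{U \<in> ?S. (R O T) `` {x} \<subseteq> U}"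
    using x unfolding star_comp_def by auto
  have e3: "\<Inter>{U \<in> ?S. (R O T) `` {x} \<subseteq> U} \<subseteq> points \<Z>"
    using top_in_co_subbase[OF Z] sub by blast
  show "star_comp \<X> \<Z> T R `` {x} = \<Inter>{U \<in> ?S. star_comp \<X> \<Z> T R `` {x} \<subseteq> U}"
    unfolding e1 unfolding e2 by (rule Int_absorb1[OF e3])
qed

section \<open>Algebras represented by a subbase\<close>

lemma eslata_closed:
  assumes "is_eslata A"
  shows "\<one>\<^bsub>A\<^esub> \<in> carrier A"
    and "\<lbrakk>a \<in> carrier A; b \<in> carrier A\<rbrakk> \<Longrightarrow> a \<otimes>\<^bsub>A\<^esub> b \<in> carrier A"
    and "a \<in> carrier A \<Longrightarrow> opP A a \<in> carrier A" "a \<in> carrier A \<Longrightarrow> opG A a \<in> carrier A"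
    and "a \<in> carrier A \<Longrightarrow> opF A a \<in> carrier A" "a \<in> carrier A \<Longrightarrow> opH A a \<in> carrier A"
proof -
  have "monoid A"
    using assms unfolding is_eslata_def meet_semilattice_def comm_monoid_def by blast
  then show "\<one>\<^bsub>A\<^esub> \<in> carrier A"
    and "\<lbrakk>a \<in> carrier A; b \<in> carrier A\<rbrakk> \<Longrightarrow> a \<otimes>\<^bsub>A\<^esub> b \<in> carrier A"
    by (simp_all add: monoid.one_closed monoid.m_closed)
qed (use assms in \<open>auto simp: is_eslata_def\<close>)

text \<open>
  A set \<open>Z\<close> hits \<open>m\<^sub>R(U)\<close> iff \<open>R(w) \<subseteq> L\<^sub>U\<close> for some \<open>w \<in> Z\<close>. Thus the last two conditions on an SLata-space
  say \<open>U \<subseteq> m\<^sub>D(m\<^sub>I(U))\<close> and \<open>m\<^sub>I(m\<^sub>D(U)) \<subseteq> U\<close>, which for monotone operators is the adjunction \<open>m\<^sub>I \<stileturn> m\<^sub>D\<close>.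
\<close>

lemma slata_space_iff_adjoint:
  assumes I: "mS_space X \<K> I" and D: "mS_space X \<K> D"
  shows "slata_space X \<K> I D \<longleftrightarrow>
    (\<forall>U \<in> co_subbase X \<K>. \<forall>V \<in> co_subbase X \<K>. m_op X \<K> I U \<subseteq> V \<longleftrightarrow> U \<subseteq> m_op X \<K> D V)"
    (is "_ = ?adj")
proof -
  have m_in: "m_op X \<K> I U \<in> co_subbase X \<K>" "m_op X \<K> D U \<in> co_subbase X \<K>"
    if "U \<in> co_subbase X \<K>" for U
    using I D that unfolding mS_space_def by simp_all
  have mono: "m_op X \<K> R U \<subseteq> m_op X \<K> R V" if "U \<subseteq> V" for R U V
    using that unfolding m_op_def hits_def by blast
  have hit: "Z \<in> hits X \<K> (m_op X \<K> R U) \<longleftrightarrow> (\<exists>w \<in> Z. R `` {w} \<subseteq> hits X \<K> U)"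
    if "Z \<in> sat_sets X \<K>" for R U Z
    using that unfolding hits_def[of X \<K> "m_op X \<K> R U"]
    unfolding m_op_def sat_sets_def by blast
  have sat: "Z \<in> sat_sets X \<K>" if "Z \<in> I `` {x} \<or> Z \<in> D `` {x}" for x Z
    using I D that unfolding mS_space_def by blast
  have unit: "U \<subseteq> m_op X \<K> D (m_op X \<K> I U) \<longleftrightarrow>
      (\<forall>x \<in> U. \<forall>Z \<in> D `` {x}. \<exists>w \<in> Z. I `` {w} \<subseteq> hits X \<K> U)" if "U \<in> co_subbase X \<K>" for U
  proof -
    have "U \<subseteq> m_op X \<K> D (m_op X \<K> I U) \<longleftrightarrow>
        (\<forall>x \<in> U. \<forall>Z \<in> D `` {x}. Z \<in> hits X \<K> (m_op X \<K> I U))"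
      using co_subbase_subset[OF that] unfolding m_op_def[of X \<K> D] by blast
    then show ?thesis using hit sat by metis
  qed
  have counit: "m_op X \<K> I (m_op X \<K> D U) \<subseteq> U \<longleftrightarrow>
      (\<forall>x \<in> X. (\<forall>Z \<in> I `` {x}. \<exists>y \<in> Z. D `` {y} \<subseteq> hits X \<K> U) \<longrightarrow> x \<in> U)" for U
  proof -
    have "m_op X \<K> I (m_op X \<K> D U) \<subseteq> U \<longleftrightarrow>
        (\<forall>x \<in> X. (\<forall>Z \<in> I `` {x}. Z \<in> hits X \<K> (m_op X \<K> D U)) \<longrightarrow> x \<in> U)"
      unfolding m_op_def[of X \<K> I] by blast
    then show ?thesis using hit sat by metis
  qed
  have "slata_space X \<K> I D \<longleftrightarrow>
    (\<forall>U \<in> co_subbase X \<K>. U \<subseteq> m_op X \<K> D (m_op X \<K> I U)) \<and>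
    (\<forall>U \<in> co_subbase X \<K>. m_op X \<K> I (m_op X \<K> D U) \<subseteq> U)"
    unfolding slata_space_def using I D by (simp only: unit counit simp_thms cong: ball_cong)
  also have "\<dots> \<longleftrightarrow> ?adj"
  proof (intro iffI conjI ballI)
    fix U V assume *: "(\<forall>U \<in> co_subbase X \<K>. U \<subseteq> m_op X \<K> D (m_op X \<K> I U)) \<and>
      (\<forall>U \<in> co_subbase X \<K>. m_op X \<K> I (m_op X \<K> D U) \<subseteq> U)"
      and U: "U \<in> co_subbase X \<K>" and V: "V \<in> co_subbase X \<K>"
    show "m_op X \<K> I U \<subseteq> V" if "U \<subseteq> m_op X \<K> D V"
      using * V mono[OF that, of I] by (meson subset_trans)
    show "U \<subseteq> m_op X \<K> D V" if "m_op X \<K> I U \<subseteq> V"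
      using * U mono[OF that, of D] by (meson subset_trans)
  next
    fix U assume *: ?adj and U: "U \<in> co_subbase X \<K>"
    show "U \<subseteq> m_op X \<K> D (m_op X \<K> I U)" using * U m_in(1)[OF U] by (meson order_refl)
    show "m_op X \<K> I (m_op X \<K> D U) \<subseteq> U" using * U m_in(2)[OF U] by (meson order_refl)
  qed
  finally show ?thesis .
qed

text \<open>
  An isomorphism from \<open>A\<close> onto \<open>S(X)\<close> with the operators \<open>m\<^sub>R\<close>. The axioms that relate the four operators,
  or the four multirelations, to each other are left out, so that they can be transferred in both
  directions.
\<close>

locale subbase_representation =
  fixes \<X> :: "'b es_space" and A :: "'a eslata" and r :: "'a \<Rightarrow> 'b set"
  assumes mS: "mS_space (points \<X>) (subbase \<X>) (relI1 \<X>)" "mS_space (points \<X>) (subbase \<X>) (relD1 \<X>)"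
      "mS_space (points \<X>) (subbase \<X>) (relI2 \<X>)" "mS_space (points \<X>) (subbase \<X>) (relD2 \<X>)"
    and closed: "\<one>\<^bsub>A\<^esub> \<in> carrier A"
      "\<And>a b. \<lbrakk>a \<in> carrier A; b \<in> carrier A\<rbrakk> \<Longrightarrow> a \<otimes>\<^bsub>A\<^esub> b \<in> carrier A"
      "\<And>a. a \<in> carrier A \<Longrightarrow> opP A a \<in> carrier A" "\<And>a. a \<in> carrier A \<Longrightarrow> opG A a \<in> carrier A"
      "\<And>a. a \<in> carrier A \<Longrightarrow> opF A a \<in> carrier A" "\<And>a. a \<in> carrier A \<Longrightarrow> opH A a \<in> carrier A"
    and r_bij: "bij_betw r (carrier A) (co_subbase (points \<X>) (subbase \<X>))"
    and r_meet: "r \<one>\<^bsub>A\<^esub> = points \<X>"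
      "\<And>a b. \<lbrakk>a \<in> carrier A; b \<in> carrier A\<rbrakk> \<Longrightarrow> r (a \<otimes>\<^bsub>A\<^esub> b) = r a \<inter> r b"
    and r_ops: "\<And>a. a \<in> carrier A \<Longrightarrow> r (opP A a) = m_op (points \<X>) (subbase \<X>) (relI1 \<X>) (r a)"
      "\<And>a. a \<in> carrier A \<Longrightarrow> r (opG A a) = m_op (points \<X>) (subbase \<X>) (relD1 \<X>) (r a)"
      "\<And>a. a \<in> carrier A \<Longrightarrow> r (opF A a) = m_op (points \<X>) (subbase \<X>) (relI2 \<X>) (r a)"
      "\<And>a. a \<in> carrier A \<Longrightarrow> r (opH A a) = m_op (points \<X>) (subbase \<X>) (relD2 \<X>) (r a)"
begin

abbreviation "X \<equiv> points \<X>"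
abbreviation "\<K> \<equiv> subbase \<X>"
abbreviation "S \<equiv> co_subbase X \<K>"

lemma space: "s_space X \<K>"
  using mS(1) unfolding mS_space_def by blast

lemma r_in: "a \<in> carrier A \<Longrightarrow> r a \<in> S"
  using r_bij bij_betwE by blast

lemma r_inject: "\<lbrakk>a \<in> carrier A; b \<in> carrier A\<rbrakk> \<Longrightarrow> r a = r b \<longleftrightarrow> a = b"
  using r_bij by (auto simp: bij_betw_def inj_on_eq_iff)

lemma r_image: "S = r ` carrier A"
  using r_bij by (simp add: bij_betw_def)

definition r_inv :: "'b set \<Rightarrow> 'a" where
  "r_inv = inv_into (carrier A) r"

lemma r_inv: "U \<in> S \<Longrightarrow> r_inv U \<in> carrier A" "U \<in> S \<Longrightarrow> r (r_inv U) = U" "a \<in> carrier A \<Longrightarrow> r_inv (r a) = a"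
proof -
  show "U \<in> S \<Longrightarrow> r_inv U \<in> carrier A" "U \<in> S \<Longrightarrow> r (r_inv U) = U"
    unfolding r_inv_def r_image by (rule inv_into_into f_inv_into_f; assumption)+
  show "a \<in> carrier A \<Longrightarrow> r_inv (r a) = a"
    using r_bij unfolding r_inv_def bij_betw_def by simp
qed

lemma sle_iff: "\<lbrakk>a \<in> carrier A; b \<in> carrier A\<rbrakk> \<Longrightarrow> sle A a b \<longleftrightarrow> r a \<subseteq> r b"
  unfolding sle_def using r_inject[of a "a \<otimes>\<^bsub>A\<^esub> b"] by (auto simp: closed r_meet)

lemma meet_semilattice: "meet_semilattice A"
  unfolding meet_semilattice_def
proof (intro conjI ballI comm_monoidI)
  fix a b c assume "a \<in> carrier A" "b \<in> carrier A" "c \<in> carrier A"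
  then show "a \<otimes>\<^bsub>A\<^esub> b \<otimes>\<^bsub>A\<^esub> c = a \<otimes>\<^bsub>A\<^esub> (b \<otimes>\<^bsub>A\<^esub> c)"
    by (subst r_inject[symmetric]) (auto simp: closed r_meet)
next
  fix a b assume "a \<in> carrier A" "b \<in> carrier A"
  then show "a \<otimes>\<^bsub>A\<^esub> b = b \<otimes>\<^bsub>A\<^esub> a"
    by (subst r_inject[symmetric]) (auto simp: closed r_meet)
next
  fix a assume a: "a \<in> carrier A"
  then show "\<one>\<^bsub>A\<^esub> \<otimes>\<^bsub>A\<^esub> a = a"
    using co_subbase_subset[OF r_in[OF a]] by (subst r_inject[symmetric]) (auto simp: closed r_meet)
next
  fix a assume "a \<in> carrier A"
  then show "a \<otimes>\<^bsub>A\<^esub> a = a"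
    by (subst r_inject[symmetric]) (auto simp: closed r_meet)
qed (simp_all add: closed)

lemma adjoint_iff_slata_space:
  assumes "mS_space X \<K> I" "mS_space X \<K> D"
    and "\<And>a. a \<in> carrier A \<Longrightarrow> f a \<in> carrier A" "\<And>a. a \<in> carrier A \<Longrightarrow> g a \<in> carrier A"
    and "\<And>a. a \<in> carrier A \<Longrightarrow> r (f a) = m_op X \<K> I (r a)"
    and "\<And>a. a \<in> carrier A \<Longrightarrow> r (g a) = m_op X \<K> D (r a)"
  shows "adjoint_ops A f g \<longleftrightarrow> slata_space X \<K> I D"
  unfolding slata_space_iff_adjoint[OF assms(1,2)] adjoint_ops_def r_image
  by (simp add: sle_iff assms(3-))

text \<open>
  Under the isomorphism \<open>r\<close> the order of \<open>A\<close> is inclusion, so the adjunctions in \<open>A\<close> become those of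
  \<open>slata_space_iff_adjoint\<close>, and the inequalities linking \<open>P, G\<close> with \<open>F, H\<close> become inclusions, which the
  axioms of ESLata-spaces state pointwise.
\<close>

theorem is_eslata_iff_is_eslata_space: "is_eslata A \<longleftrightarrow> is_eslata_space \<X>"
proof -
  have m: "m_op X \<K> R U \<inter> m_op X \<K> Q V \<subseteq> m_op X \<K> Q (U \<inter> V) \<longleftrightarrow>
      (\<forall>x \<in> X. R `` {x} \<subseteq> hits X \<K> U \<and> Q `` {x} \<subseteq> hits X \<K> V \<longrightarrow> Q `` {x} \<subseteq> hits X \<K> (U \<inter> V))"
    for R Q U V
    unfolding m_op_def by blast
  have sle1: "sle A (opG A a \<otimes>\<^bsub>A\<^esub> opF A b) (opF A (a \<otimes>\<^bsub>A\<^esub> b)) \<longleftrightarrow>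
      m_op X \<K> (relD1 \<X>) (r a) \<inter> m_op X \<K> (relI2 \<X>) (r b) \<subseteq> m_op X \<K> (relI2 \<X>) (r a \<inter> r b)"
    and sle2: "sle A (opH A a \<otimes>\<^bsub>A\<^esub> opP A b) (opP A (a \<otimes>\<^bsub>A\<^esub> b)) \<longleftrightarrow>
      m_op X \<K> (relD2 \<X>) (r a) \<inter> m_op X \<K> (relI1 \<X>) (r b) \<subseteq> m_op X \<K> (relI1 \<X>) (r a \<inter> r b)"
    if "a \<in> carrier A" "b \<in> carrier A" for a b
    using that by (simp_all add: sle_iff closed r_meet r_ops)
  have T3: "(\<forall>a \<in> carrier A. \<forall>b \<in> carrier A.
        sle A (opG A a \<otimes>\<^bsub>A\<^esub> opF A b) (opF A (a \<otimes>\<^bsub>A\<^esub> b)) \<and>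
        sle A (opH A a \<otimes>\<^bsub>A\<^esub> opP A b) (opP A (a \<otimes>\<^bsub>A\<^esub> b))) \<longleftrightarrow>
      (\<forall>U \<in> S. \<forall>V \<in> S.
        m_op X \<K> (relD1 \<X>) U \<inter> m_op X \<K> (relI2 \<X>) V \<subseteq> m_op X \<K> (relI2 \<X>) (U \<inter> V) \<and>
        m_op X \<K> (relD2 \<X>) U \<inter> m_op X \<K> (relI1 \<X>) V \<subseteq> m_op X \<K> (relI1 \<X>) (U \<inter> V))"
    unfolding r_image by (simp add: sle1 sle2)
  have adj1: "adjoint_ops A (opP A) (opG A) \<longleftrightarrow> slata_space X \<K> (relI1 \<X>) (relD1 \<X>)"
    by (rule adjoint_iff_slata_space) (simp_all add: mS closed r_ops)
  have adj2: "adjoint_ops A (opF A) (opH A) \<longleftrightarrow> slata_space X \<K> (relI2 \<X>) (relD2 \<X>)"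
    by (rule adjoint_iff_slata_space) (simp_all add: mS closed r_ops)
  have "is_eslata A \<longleftrightarrow> slata_space X \<K> (relI1 \<X>) (relD1 \<X>) \<and> slata_space X \<K> (relI2 \<X>) (relD2 \<X>) \<and>
      (\<forall>U \<in> S. \<forall>V \<in> S.
        m_op X \<K> (relD1 \<X>) U \<inter> m_op X \<K> (relI2 \<X>) V \<subseteq> m_op X \<K> (relI2 \<X>) (U \<inter> V) \<and>
        m_op X \<K> (relD2 \<X>) U \<inter> m_op X \<K> (relI1 \<X>) V \<subseteq> m_op X \<K> (relI1 \<X>) (U \<inter> V))"
    unfolding is_eslata_def T3 adj1 adj2 using meet_semilattice closed by (simp add: Pi_iff)
  also have "\<dots> \<longleftrightarrow> is_eslata_space \<X>"
    unfolding is_eslata_space_def Let_def m by (intro conj_cong refl) blast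
  finally show ?thesis .
qed

end

text \<open>
  This is why a size condition on the subbase of a space matches one on the carrier of an algebra.
\<close>

lemma (in subbase_representation) subbase_eqpoll_carrier: "\<K> \<approx> carrier A"
  using eqpoll_sym[OF co_subbase_eqpoll[OF space]] r_bij by (meson eqpoll_def eqpoll_sym eqpoll_trans)

section \<open>Relations and homomorphisms\<close>

text \<open>
  The box operator \<open>S(Y) \<rightarrow> S(X)\<close> carried over to the algebras along the isomorphisms \<open>r\<close> and \<open>s\<close>. The tuples
  are the links of the final application of \<open>linked_categories\<close>.
\<close>

definition dual_hom :: "'b es_space \<times> 'a eslata \<times> ('a \<Rightarrow> 'b set) \<Rightarrow>
    'b es_space \<times> 'a eslata \<times> ('a \<Rightarrow> 'b set) \<Rightarrow> ('b \<times> 'b) set \<Rightarrow> 'a \<Rightarrow> 'a" where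
  "dual_hom = (\<lambda>(\<X>, A, r) (\<Y>, B, s) T.
     \<lambda>b \<in> carrier B. inv_into (carrier A) r (box_op (points \<X>) T (s b)))"

locale two_representations =
  dom: subbase_representation \<X> A r + cod: subbase_representation \<Y> B s
  for \<X> :: "'b es_space" and A :: "'a eslata" and r and \<Y> :: "'b es_space" and B :: "'a eslata" and s
begin

abbreviation h :: "('b \<times> 'b) set \<Rightarrow> 'a \<Rightarrow> 'a" where
  "h \<equiv> dual_hom (\<X>, A, r) (\<Y>, B, s)"

text \<open>
  The commutation conditions on an ESLata-relation range over \<open>S(Y)\<close>, that is, over the values of \<open>s\<close>.
\<close>

lemma eslata_relation_iff:
  "eslata_relation \<X> \<Y> T \<longleftrightarrow> meet_relation dom.X dom.\<K> cod.X cod.\<K> T \<and>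
    (\<forall>b \<in> carrier B.
      box_op dom.X T (s (opP B b)) = m_op dom.X dom.\<K> (relI1 \<X>) (box_op dom.X T (s b)) \<and>
      box_op dom.X T (s (opG B b)) = m_op dom.X dom.\<K> (relD1 \<X>) (box_op dom.X T (s b)) \<and>
      box_op dom.X T (s (opF B b)) = m_op dom.X dom.\<K> (relI2 \<X>) (box_op dom.X T (s b)) \<and>
      box_op dom.X T (s (opH B b)) = m_op dom.X dom.\<K> (relD2 \<X>) (box_op dom.X T (s b)))"
  unfolding eslata_relation_def slata_relation_def cod.r_image
  by (auto simp: cod.r_ops)

lemma r_dual_hom:
  assumes "meet_relation dom.X dom.\<K> cod.X cod.\<K> T" "b \<in> carrier B"
  shows "h T b \<in> carrier A" "r (h T b) = box_op dom.X T (s b)"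
proof -
  have "box_op dom.X T (s b) \<in> dom.S"
    using assms cod.r_in unfolding meet_relation_def by blast
  then show "h T b \<in> carrier A" "r (h T b) = box_op dom.X T (s b)"
    using dom.r_inv assms(2) by (simp_all add: dual_hom_def dom.r_inv_def)
qed

lemma dual_hom_in:
  assumes "eslata_relation \<X> \<Y> T"
  shows "h T \<in> eslata_hom B A"
proof -
  have T: "meet_relation dom.X dom.\<K> cod.X cod.\<K> T" using assms eslata_relation_iff by blast
  note hT [simp] = r_dual_hom[OF T]
  have eqI: "h T b = a" if "b \<in> carrier B" "a \<in> carrier A" "box_op dom.X T (s b) = r a" for a b
    using dom.r_inject[of "h T b" a] that by simp
  have "h T (x \<otimes>\<^bsub>B\<^esub> y) = h T x \<otimes>\<^bsub>A\<^esub> h T y" if "x \<in> carrier B" "y \<in> carrier B" for x y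
    using that by (intro eqI) (auto simp: cod.closed dom.closed cod.r_meet dom.r_meet box_op_def)
  moreover have "h T \<one>\<^bsub>B\<^esub> = \<one>\<^bsub>A\<^esub>"
  proof (rule eqI)
    have "T \<subseteq> dom.X \<times> cod.X" using T unfolding meet_relation_def by blast
    then show "box_op dom.X T (s \<one>\<^bsub>B\<^esub>) = r \<one>\<^bsub>A\<^esub>"
      unfolding cod.r_meet dom.r_meet box_op_def by blast
  qed (simp_all add: cod.closed dom.closed)
  moreover have "h T (opP B x) = opP A (h T x) \<and> h T (opG B x) = opG A (h T x) \<and>
      h T (opF B x) = opF A (h T x) \<and> h T (opH B x) = opH A (h T x)" if x: "x \<in> carrier B" for x
    using assms x unfolding eslata_relation_iff
    by (intro conjI eqI) (simp_all add: cod.closed dom.closed dom.r_ops)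
  moreover have "h T \<in> extensional (carrier B)" by (simp add: dual_hom_def)
  ultimately show ?thesis
    unfolding eslata_hom_def by (auto intro!: homI)
qed

text \<open>
  Injectivity is the recovery of a meet-relation from its box operator. For surjectivity a homomorphism
  is carried to a meet-homomorphism \<open>S(Y) \<rightarrow> S(X)\<close>, which is a box operator by
  \<open>meet_relation_of_meet_hom\<close>; that it preserves \<open>P, G, F, H\<close> is the commutation condition.
\<close>

lemma dual_hom_bij: "bij_betw h {T. eslata_relation \<X> \<Y> T} (eslata_hom B A)"
  unfolding bij_betw_def
proof (intro conjI equalityI subsetI)
  show "inj_on h {T. eslata_relation \<X> \<Y> T}"
  proof (rule inj_onI; simp)
    fix T T' assume "eslata_relation \<X> \<Y> T" "eslata_relation \<X> \<Y> T'" and eq: "h T = h T'"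
    then have T: "meet_relation dom.X dom.\<K> cod.X cod.\<K> T"
      and T': "meet_relation dom.X dom.\<K> cod.X cod.\<K> T'" using eslata_relation_iff by blast+
    show "T = T'"
    proof (rule meet_relation_eqI[OF T T'])
      fix U assume "U \<in> cod.S"
      then obtain b where "b \<in> carrier B" "U = s b" unfolding cod.r_image by blast
      then show "box_op dom.X T U = box_op dom.X T' U"
        using r_dual_hom(2)[OF T] r_dual_hom(2)[OF T'] eq by metis
    qed
  qed
  show "g \<in> eslata_hom B A" if "g \<in> h ` {T. eslata_relation \<X> \<Y> T}" for g
    using that dual_hom_in by blast
  fix g assume g: "g \<in> eslata_hom B A"
  have g_in [simp]: "b \<in> carrier B \<Longrightarrow> g b \<in> carrier A" for b
    using g unfolding eslata_hom_def by (auto simp: hom_def)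
  have g_mult: "\<lbrakk>b \<in> carrier B; c \<in> carrier B\<rbrakk> \<Longrightarrow> g (b \<otimes>\<^bsub>B\<^esub> c) = g b \<otimes>\<^bsub>A\<^esub> g c" for b c
    using g unfolding eslata_hom_def by (auto simp: hom_def)
  have g_one: "g \<one>\<^bsub>B\<^esub> = \<one>\<^bsub>A\<^esub>" and g_ext: "g \<in> extensional (carrier B)"
    using g unfolding eslata_hom_def by blast+
  have g_ops: "g (opP B b) = opP A (g b)" "g (opG B b) = opG A (g b)"
    "g (opF B b) = opF A (g b)" "g (opH B b) = opH A (g b)" if "b \<in> carrier B" for b
    using g that unfolding eslata_hom_def by simp_all
  \<comment> \<open>The homomorphism transported to the complements of the subbases.\<close>
  define G where "G = (\<lambda>U. r (g (cod.r_inv U)))"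
  have G_s: "G (s b) = r (g b)" if "b \<in> carrier B" for b
    using that by (simp add: G_def cod.r_inv)
  obtain T where T: "meet_relation dom.X dom.\<K> cod.X cod.\<K> T"
    and box: "\<And>U. U \<in> cod.S \<Longrightarrow> box_op dom.X T U = G U"
  proof (rule meet_relation_of_meet_hom[OF cod.space, of G dom.X dom.\<K>])
    show "G U \<in> dom.S" if "U \<in> cod.S" for U
      using that unfolding G_def by (simp add: dom.r_in cod.r_inv)
    show "G cod.X = dom.X"
      using G_s[of "\<one>\<^bsub>B\<^esub>"] by (simp add: cod.closed cod.r_meet dom.r_meet g_one)
    show "G (U \<inter> V) = G U \<inter> G V" if UV: "U \<in> cod.S" "V \<in> cod.S" for U V
    proof -
      obtain b c where "b \<in> carrier B" "c \<in> carrier B" "U = s b" "V = s c"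
        using UV unfolding cod.r_image by blast
      then show ?thesis
        using G_s[of "b \<otimes>\<^bsub>B\<^esub> c"] by (simp add: cod.closed cod.r_meet G_s g_mult dom.r_meet)
    qed
  qed (rule that)
  have box_s: "box_op dom.X T (s b) = r (g b)" if "b \<in> carrier B" for b
    using box[OF cod.r_in[OF that]] G_s[OF that] by simp
  have "eslata_relation \<X> \<Y> T"
    unfolding eslata_relation_iff using T by (simp add: box_s cod.closed g_ops dom.r_ops)
  moreover have "h T = g"
  proof (rule extensionalityI[OF _ g_ext])
    show "h T \<in> extensional (carrier B)" by (simp add: dual_hom_def)
    show "h T b = g b" if "b \<in> carrier B" for b
      using dom.r_inject[of "h T b" "g b"] r_dual_hom[OF T that] box_s[OF that] that by simp
  qed
  ultimately show "g \<in> h ` {T. eslata_relation \<X> \<Y> T}" by blast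
qed

end

context subbase_representation
begin

lemma eslata_relation_dual_specialization: "eslata_relation \<X> \<X> (dual_specialization \<X>)"
proof -
  interpret two_representations \<X> A r \<X> A r by unfold_locales
  show ?thesis
    unfolding eslata_relation_iff
    using meet_relation_dual_specialization[OF space] box_op_dual_specialization[OF space]
    by (simp add: r_in closed r_ops[symmetric])
qed

lemma dual_hom_dual_specialization:
  "dual_hom (\<X>, A, r) (\<X>, A, r) (dual_specialization \<X>) = restrict (\<lambda>x. x) (carrier A)"
  unfolding dual_hom_def using box_op_dual_specialization[OF space] r_inv(3) r_in
  by (auto simp: restrict_def r_inv_def)

end

locale three_representations =
  XY: two_representations \<X> A r \<Y> B s + YZ: two_representations \<Y> B s \<Z> C t
  for \<X> :: "'b es_space" and A :: "'a eslata" and r and \<Y> :: "'b es_space" and B :: "'a eslata" and s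
    and \<Z> :: "'b es_space" and C :: "'a eslata" and t
begin

sublocale XZ: two_representations \<X> A r \<Z> C t by unfold_locales

lemma
  assumes R: "eslata_relation \<X> \<Y> R" and T: "eslata_relation \<Y> \<Z> T"
  shows eslata_relation_star_comp: "eslata_relation \<X> \<Z> (star_comp \<X> \<Z> T R)"
    and dual_hom_star_comp: "XZ.h (star_comp \<X> \<Z> T R) = compose (carrier C) (XY.h R) (YZ.h T)"
proof -
  have R': "meet_relation XY.dom.X XY.dom.\<K> XY.cod.X XY.cod.\<K> R"
    and T': "meet_relation XY.cod.X XY.cod.\<K> YZ.cod.X YZ.cod.\<K> T"
    using R T unfolding XY.eslata_relation_iff YZ.eslata_relation_iff by blast+
  then have sub: "R \<subseteq> XY.dom.X \<times> XY.cod.X" "T \<subseteq> XY.cod.X \<times> YZ.cod.X"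
    unfolding meet_relation_def by blast+
  have box: "box_op XY.dom.X (star_comp \<X> \<Z> T R) (t c) = r (XY.h R (YZ.h T c))" if "c \<in> carrier C" for c
    using that unfolding box_op_star_comp[OF sub YZ.cod.r_in[OF that]]
    by (simp add: XY.r_dual_hom[OF R'] YZ.r_dual_hom[OF T'])
  have hom: "XY.h R \<in> eslata_hom B A" "YZ.h T \<in> eslata_hom C B"
    using R T XY.dual_hom_in YZ.dual_hom_in by blast+
  have ops: "XY.h R (YZ.h T (f C c)) = f A (XY.h R (YZ.h T c))"
    if "f \<in> {opP, opG, opF, opH}" "c \<in> carrier C" for c f
    using that hom YZ.r_dual_hom(1)[OF T'] unfolding eslata_hom_def by auto
  have in_A: "XY.h R (YZ.h T c) \<in> carrier A" if "c \<in> carrier C" for c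
    using that by (simp add: XY.r_dual_hom[OF R'] YZ.r_dual_hom[OF T'])
  show "eslata_relation \<X> \<Z> (star_comp \<X> \<Z> T R)"
    unfolding XZ.eslata_relation_iff
    using meet_relation_star_comp[OF R' T' YZ.cod.space]
    by (simp add: box YZ.cod.closed ops in_A XY.dom.r_ops)
  show "XZ.h (star_comp \<X> \<Z> T R) = compose (carrier C) (XY.h R) (YZ.h T)"
  proof (rule extensionalityI[of _ "carrier C"])
    show "XZ.h (star_comp \<X> \<Z> T R) \<in> extensional (carrier C)" by (simp add: dual_hom_def)
    fix c assume c: "c \<in> carrier C"
    have "XZ.h (star_comp \<X> \<Z> T R) c = XY.dom.r_inv (r (XY.h R (YZ.h T c)))"
      using c box[OF c] by (simp add: dual_hom_def XY.dom.r_inv_def)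
    then show "XZ.h (star_comp \<X> \<Z> T R) c = compose (carrier C) (XY.h R) (YZ.h T) c"
      using c XY.dom.r_inv(3)[OF in_A[OF c]] by (simp add: compose_def)
  qed (rule compose_extensional)
qed

end

section \<open>The algebra of a space\<close>

definition algebra_of_space :: "'b es_space \<Rightarrow> 'a set \<Rightarrow> ('a \<Rightarrow> 'b set) \<Rightarrow> 'a eslata" where
  "algebra_of_space \<X> C r =
    (let X = points \<X>; \<K> = subbase \<X>; e = inv_into C r in
     \<lparr>carrier = C, mult = (\<lambda>a b. e (r a \<inter> r b)), one = e X,
      opP = (\<lambda>a. e (m_op X \<K> (relI1 \<X>) (r a))), opG = (\<lambda>a. e (m_op X \<K> (relD1 \<X>) (r a))),
      opF = (\<lambda>a. e (m_op X \<K> (relI2 \<X>) (r a))), opH = (\<lambda>a. e (m_op X \<K> (relD2 \<X>) (r a)))\<rparr>)"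

lemma algebra_of_space_representation:
  assumes \<X>: "is_eslata_space \<X>" and r: "bij_betw r C (co_subbase (points \<X>) (subbase \<X>))"
  shows "subbase_representation \<X> (algebra_of_space \<X> C r) r"
proof -
  let ?X = "points \<X>" and ?\<K> = "subbase \<X>"
  let ?S = "co_subbase ?X ?\<K>"
  have mS: "mS_space ?X ?\<K> (relI1 \<X>)" "mS_space ?X ?\<K> (relD1 \<X>)"
    "mS_space ?X ?\<K> (relI2 \<X>)" "mS_space ?X ?\<K> (relD2 \<X>)"
    using \<X> unfolding is_eslata_space_def slata_space_def Let_def by simp_all
  then have space: "s_space ?X ?\<K>" unfolding mS_space_def by simp
  have r_in: "r a \<in> ?S" if "a \<in> C" for a
    using r that bij_betwE by blast
  have m_in: "m_op ?X ?\<K> R (r a) \<in> ?S" if "mS_space ?X ?\<K> R" "a \<in> C" for R a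
    using that r_in unfolding mS_space_def by simp
  have inv: "inv_into C r U \<in> C" "r (inv_into C r U) = U" if "U \<in> ?S" for U
    using that r by (simp_all add: bij_betw_def inv_into_into f_inv_into_f)
  note inside = top_in_co_subbase[OF space] Int_in_co_subbase[OF space]
  show ?thesis
    by unfold_locales
      (simp_all add: mS r algebra_of_space_def Let_def inv inside r_in m_in)
qed

text \<open>
  The algebra \<open>S(X)\<close> consists of sets of points, so its structure is moved to the given carrier along a
  bijection.
\<close>

lemma ex_dual_algebra:
  fixes \<X> :: "'b es_space" and C :: "'a set"
  assumes \<X>: "is_eslata_space \<X>" and C: "subbase \<X> \<approx> C"
  obtains A :: "'a eslata" and r where "subbase_representation \<X> A r" "carrier A = C"
proof -
  let ?S = "co_subbase (points \<X>) (subbase \<X>)"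
  have "s_space (points \<X>) (subbase \<X>)"
    using \<X> unfolding is_eslata_space_def slata_space_def mS_space_def Let_def by simp
  from eqpoll_trans[OF co_subbase_eqpoll[OF this] C] have "C \<approx> ?S" by (rule eqpoll_sym)
  then obtain r where r: "bij_betw r C ?S" unfolding eqpoll_def by blast
  show thesis
  proof (rule that)
    show "subbase_representation \<X> (algebra_of_space \<X> C r) r"
      by (rule algebra_of_space_representation[OF \<X> r])
    show "carrier (algebra_of_space \<X> C r) = C"
      by (simp add: algebra_of_space_def Let_def)
  qed
qed

section \<open>Filters of a meet-semilattice\<close>

locale semilattice_with_top =
  fixes A :: "('a, 'z) monoid_scheme" (structure)
  assumes semilattice: "meet_semilattice A"
begin

sublocale comm_monoid A
  using semilattice unfolding meet_semilattice_def by blast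

abbreviation le :: "'a \<Rightarrow> 'a \<Rightarrow> bool" (infix "\<preceq>" 50) where
  "a \<preceq> b \<equiv> sle A a b"

lemma idem: "a \<in> carrier A \<Longrightarrow> a \<otimes> a = a"
  using semilattice unfolding meet_semilattice_def by blast

lemma le_refl: "a \<in> carrier A \<Longrightarrow> a \<preceq> a"
  by (simp add: sle_def idem)

lemma le_trans: "\<lbrakk>a \<preceq> b; b \<preceq> c; a \<in> carrier A; b \<in> carrier A; c \<in> carrier A\<rbrakk> \<Longrightarrow> a \<preceq> c"
  unfolding sle_def by (metis m_assoc)

lemma le_one: "a \<in> carrier A \<Longrightarrow> a \<preceq> \<one>"
  by (simp add: sle_def)

lemma mult_le2: "\<lbrakk>a \<in> carrier A; b \<in> carrier A\<rbrakk> \<Longrightarrow> a \<otimes> b \<preceq> b"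
  by (simp add: sle_def m_assoc idem)

lemma mult_le1: "\<lbrakk>a \<in> carrier A; b \<in> carrier A\<rbrakk> \<Longrightarrow> a \<otimes> b \<preceq> a"
  using mult_le2[of b a] by (simp add: m_comm)

lemma le_mult: "\<lbrakk>c \<preceq> a; c \<preceq> b; a \<in> carrier A; b \<in> carrier A; c \<in> carrier A\<rbrakk> \<Longrightarrow> c \<preceq> a \<otimes> b"
  unfolding sle_def by (metis m_assoc)

lemma mult_mono:
  assumes "a \<preceq> b" "c \<preceq> d" and c: "a \<in> carrier A" "b \<in> carrier A" "c \<in> carrier A" "d \<in> carrier A"
  shows "a \<otimes> c \<preceq> b \<otimes> d"
proof (rule le_mult)
  show "a \<otimes> c \<preceq> b" using le_trans[OF mult_le1 assms(1)] c by simp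
  show "a \<otimes> c \<preceq> d" using le_trans[OF mult_le2 assms(2)] c by simp
qed (simp_all add: c)

definition filters :: "'a set set" where
  "filters = {F. F \<subseteq> carrier A \<and> \<one> \<in> F \<and> (\<forall>a \<in> F. \<forall>b \<in> F. a \<otimes> b \<in> F) \<and>
    (\<forall>a \<in> F. \<forall>b \<in> carrier A. a \<preceq> b \<longrightarrow> b \<in> F)}"

definition irreducible_filters :: "'a set set" where
  "irreducible_filters = {P \<in> filters. P \<noteq> carrier A \<and>
    (\<forall>F \<in> filters. \<forall>G \<in> filters. P = F \<inter> G \<longrightarrow> P = F \<or> P = G)}"

lemma filterD:
  assumes "F \<in> filters"
  shows "F \<subseteq> carrier A" "\<one> \<in> F" "\<lbrakk>a \<in> F; b \<in> F\<rbrakk> \<Longrightarrow> a \<otimes> b \<in> F"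
    "\<lbrakk>a \<in> F; a \<preceq> b; b \<in> carrier A\<rbrakk> \<Longrightarrow> b \<in> F"
  using assms unfolding filters_def by simp_all

lemma irreducible_filterD:
  assumes "P \<in> irreducible_filters"
  shows "P \<in> filters" "P \<noteq> carrier A" "\<lbrakk>F \<in> filters; G \<in> filters; P = F \<inter> G\<rbrakk> \<Longrightarrow> P = F \<or> P = G"
  using assms unfolding irreducible_filters_def by simp_all

text \<open>
  The filter generated by \<open>F \<union> {a}\<close>.
\<close>

definition adjoin :: "'a set \<Rightarrow> 'a \<Rightarrow> 'a set" where
  "adjoin F a = {b \<in> carrier A. \<exists>w \<in> F. w \<otimes> a \<preceq> b}"

lemma adjoin:
  assumes F: "F \<in> filters" and a: "a \<in> carrier A"
  shows "adjoin F a \<in> filters" "F \<subseteq> adjoin F a" "a \<in> adjoin F a"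
proof -
  note [simp] = subsetD[OF filterD(1)[OF F]] a
  have "b \<otimes> c \<in> adjoin F a" if bc: "b \<in> adjoin F a" "c \<in> adjoin F a" for b c
  proof -
    obtain v w where vw: "v \<in> F" "w \<in> F" "v \<otimes> a \<preceq> b" "w \<otimes> a \<preceq> c" and [simp]: "b \<in> carrier A" "c \<in> carrier A"
      using bc unfolding adjoin_def by blast
    have "(v \<otimes> w) \<otimes> a \<preceq> b"
      using vw by (intro le_trans[OF mult_mono[OF mult_le1 le_refl] vw(3)]) simp_all
    moreover have "(v \<otimes> w) \<otimes> a \<preceq> c"
      using vw by (intro le_trans[OF mult_mono[OF mult_le2 le_refl] vw(4)]) simp_all
    ultimately have "(v \<otimes> w) \<otimes> a \<preceq> b \<otimes> c" using vw by (intro le_mult) simp_all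
    then show ?thesis using vw filterD(3)[OF F] unfolding adjoin_def by auto
  qed
  moreover have "c \<in> adjoin F a" if bc: "b \<in> adjoin F a" "b \<preceq> c" "c \<in> carrier A" for b c
  proof -
    obtain v where v: "v \<in> F" "v \<otimes> a \<preceq> b" and [simp]: "b \<in> carrier A"
      using bc unfolding adjoin_def by blast
    have "v \<otimes> a \<preceq> c" using le_trans[OF v(2) bc(2)] v bc by simp
    then show ?thesis using v bc unfolding adjoin_def by auto
  qed
  moreover have "\<one> \<in> adjoin F a"
    using filterD(2)[OF F] unfolding adjoin_def by (auto intro!: bexI[of _ "\<one>"] le_one)
  moreover have "adjoin F a \<subseteq> carrier A" unfolding adjoin_def by blast
  ultimately show "adjoin F a \<in> filters" unfolding filters_def by blast
  show "F \<subseteq> adjoin F a"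
    using mult_le1[OF _ a] unfolding adjoin_def by (intro subsetI CollectI conjI bexI) simp_all
  show "a \<in> adjoin F a"
    using filterD(2)[OF F] mult_le2[OF one_closed a] a unfolding adjoin_def by blast
qed

text \<open>
  The elementwise form of irreducibility: the filters generated by \<open>P\<close> with \<open>a\<close> and by \<open>P\<close> with \<open>b\<close> are
  properly larger than \<open>P\<close>, so their intersection is not \<open>P\<close>, and \<open>d\<close> is any element of the difference.
\<close>

lemma irreducible_filter_witness:
  assumes P: "P \<in> irreducible_filters" and a: "a \<in> carrier A" "a \<notin> P" and b: "b \<in> carrier A" "b \<notin> P"
  obtains w d where "w \<in> P" "d \<in> carrier A" "d \<notin> P" "w \<otimes> a \<preceq> d" "w \<otimes> b \<preceq> d"
proof -
  note F = irreducible_filterD(1)[OF P]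
  note [simp] = subsetD[OF filterD(1)[OF F]] a(1) b(1)
  have "P \<noteq> adjoin P a \<inter> adjoin P b"
    using irreducible_filterD(3)[OF P adjoin(1) adjoin(1), OF F a(1) F b(1)] adjoin(3)[OF F] a b by blast
  moreover have "P \<subseteq> adjoin P a \<inter> adjoin P b" using adjoin(2)[OF F] a b by blast
  ultimately obtain d where d: "d \<in> adjoin P a" "d \<in> adjoin P b" "d \<notin> P" by blast
  then obtain v w where vw: "v \<in> P" "w \<in> P" "v \<otimes> a \<preceq> d" "w \<otimes> b \<preceq> d" and [simp]: "d \<in> carrier A"
    unfolding adjoin_def by blast
  show thesis
  proof (rule that[of "v \<otimes> w" d])
    show "(v \<otimes> w) \<otimes> a \<preceq> d"
      using vw by (intro le_trans[OF mult_mono[OF mult_le1 le_refl] vw(3)]) simp_all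
    show "(v \<otimes> w) \<otimes> b \<preceq> d"
      using vw by (intro le_trans[OF mult_mono[OF mult_le2 le_refl] vw(4)]) simp_all
  qed (use vw d filterD(3)[OF F] in simp_all)
qed

text \<open>
  A filter maximal among those that extend \<open>F\<close> and avoid \<open>J\<close> is irreducible: were it the intersection of
  two properly larger filters, each of them would meet \<open>J\<close>, say in \<open>a\<close> and \<open>b\<close>, and the element \<open>c \<in> J\<close>
  provided for \<open>a\<close> and \<open>b\<close> would belong to both, hence to the maximal filter. The set \<open>J\<close> is directed only
  up to meets with elements of \<open>F\<close>; this is exactly what a \<open>Y\<close>-family provides, and a singleton also
  qualifies.
\<close>

lemma irreducible_extension:
  assumes F: "F \<in> filters" and J: "J \<subseteq> carrier A" "J \<noteq> {}" and disj: "F \<inter> J = {}"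
    and dir: "\<And>a b. \<lbrakk>a \<in> J; b \<in> J\<rbrakk> \<Longrightarrow> \<exists>w \<in> F. \<exists>c \<in> J. a \<otimes> w \<preceq> c \<and> b \<otimes> w \<preceq> c"
  obtains P where "P \<in> irreducible_filters" "F \<subseteq> P" "P \<inter> J = {}"
proof -
  let ?\<G> = "{G \<in> filters. F \<subseteq> G \<and> G \<inter> J = {}}"
  have "\<exists>P \<in> ?\<G>. \<forall>G \<in> ?\<G>. P \<subseteq> G \<longrightarrow> G = P"
  proof (rule subset_Zorn_nonempty)
    show "?\<G> \<noteq> {}" using F disj by blast
    fix \<C> assume ne: "\<C> \<noteq> {}" and chain: "subset.chain ?\<G> \<C>"
    then have sub: "\<C> \<subseteq> ?\<G>" and total: "\<And>G H. \<lbrakk>G \<in> \<C>; H \<in> \<C>\<rbrakk> \<Longrightarrow> G \<subseteq> H \<or> H \<subseteq> G"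
      unfolding subset_chain_def by blast+
    have fil: "G \<in> filters" if "G \<in> \<C>" for G using that sub by blast
    have "a \<otimes> b \<in> \<Union>\<C>" if ab: "a \<in> \<Union>\<C>" "b \<in> \<Union>\<C>" for a b
    proof -
      obtain G H where "G \<in> \<C>" "a \<in> G" "H \<in> \<C>" "b \<in> H" using ab by blast
      then obtain G' where "G' \<in> \<C>" "a \<in> G'" "b \<in> G'" using total[of G H] by blast
      then show ?thesis using filterD(3)[OF fil[of G']] by blast
    qed
    moreover have "b \<in> \<Union>\<C>" if ab: "a \<in> \<Union>\<C>" "a \<preceq> b" "b \<in> carrier A" for a b
    proof -
      obtain G where "G \<in> \<C>" "a \<in> G" using ab(1) by blast
      then show ?thesis using filterD(4)[OF fil[of G] _ ab(2,3)] by blast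
    qed
    moreover have "\<one> \<in> \<Union>\<C>" using ne fil filterD(2) by blast
    moreover have "\<Union>\<C> \<subseteq> carrier A" using fil filterD(1) by blast
    ultimately have "\<Union>\<C> \<in> filters" unfolding filters_def by blast
    then show "\<Union>\<C> \<in> ?\<G>" using sub ne by blast
  qed
  then obtain P where P: "P \<in> filters" "F \<subseteq> P" "P \<inter> J = {}"
    and max: "\<And>G. \<lbrakk>G \<in> filters; P \<subseteq> G; G \<inter> J = {}\<rbrakk> \<Longrightarrow> G = P"
    by (smt (verit, ccfv_SIG) mem_Collect_eq subset_trans)
  have "P = G \<or> P = H" if G: "G \<in> filters" and H: "H \<in> filters" and PGH: "P = G \<inter> H" for G H
  proof (rule ccontr)
    assume "\<not> (P = G \<or> P = H)"
    then have "G \<inter> J \<noteq> {}" "H \<inter> J \<noteq> {}" using max[OF G] max[OF H] PGH by blast+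
    then obtain a b where a: "a \<in> G" "a \<in> J" and b: "b \<in> H" "b \<in> J" by blast
    obtain w c where w: "w \<in> F" and c: "c \<in> J" "a \<otimes> w \<preceq> c" "b \<otimes> w \<preceq> c"
      using dir[OF a(2) b(2)] by blast
    have "w \<in> G" "w \<in> H" "c \<in> carrier A" using w P(2) PGH c(1) J(1) by blast+
    then have "c \<in> G" "c \<in> H"
      using filterD(4)[OF G filterD(3)[OF G a(1)] c(2)] filterD(4)[OF H filterD(3)[OF H b(1)] c(3)] by blast+
    then show False using P(3) PGH c(1) by blast
  qed
  moreover have "P \<noteq> carrier A" using P(3) J by blast
  ultimately have "P \<in> irreducible_filters" using P(1) unfolding irreducible_filters_def by blast
  then show thesis using that P(2,3) by blast
qed

corollary irreducible_separation:
  assumes F: "F \<in> filters" and a: "a \<in> carrier A" "a \<notin> F"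
  obtains P where "P \<in> irreducible_filters" "F \<subseteq> P" "a \<notin> P"
proof (rule irreducible_extension[OF F, of "{a}"])
  show "{a} \<subseteq> carrier A" "{a} \<noteq> {}" "F \<inter> {a} = {}" using a by simp_all
  show "\<exists>w \<in> F. \<exists>c \<in> {a}. b \<otimes> w \<preceq> c \<and> b' \<otimes> w \<preceq> c" if "b \<in> {a}" "b' \<in> {a}" for b b'
    using that filterD(2)[OF F] a by (auto intro!: bexI[of _ \<one>] le_refl)
qed (simp add: that)

text \<open>
  The least filter containing \<open>B\<close>, for \<open>B \<subseteq> carrier A\<close>. Instead of forming finite meets, \<open>a\<close> is required to lie above every
  lower bound of some finite subset \<open>M\<close> of \<open>B\<close>; such an \<open>M\<close> is what yields finite subcovers below.
\<close>

definition generated :: "'a set \<Rightarrow> 'a set" where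
  "generated B = {a \<in> carrier A. \<exists>M. finite M \<and> M \<subseteq> B \<and> (\<forall>z \<in> carrier A. (\<forall>b \<in> M. z \<preceq> b) \<longrightarrow> z \<preceq> a)}"

lemma generated_filter: "generated B \<in> filters"
proof -
  have "\<one> \<in> generated B" unfolding generated_def by (auto intro!: exI[of _ "{}"] le_one)
  moreover have "a \<otimes> b \<in> generated B" if ab: "a \<in> generated B" "b \<in> generated B" for a b
  proof -
    obtain M N where "finite M" "M \<subseteq> B" "\<forall>z \<in> carrier A. (\<forall>b \<in> M. z \<preceq> b) \<longrightarrow> z \<preceq> a"
      "finite N" "N \<subseteq> B" "\<forall>z \<in> carrier A. (\<forall>b \<in> N. z \<preceq> b) \<longrightarrow> z \<preceq> b" "a \<in> carrier A" "b \<in> carrier A"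
      using ab unfolding generated_def by blast
    then show ?thesis
      unfolding generated_def by (auto intro!: exI[of _ "M \<union> N"] le_mult)
  qed
  moreover have "b \<in> generated B" if ab: "a \<in> generated B" "a \<preceq> b" "b \<in> carrier A" for a b
  proof -
    obtain M where M: "finite M" "M \<subseteq> B" "\<forall>z \<in> carrier A. (\<forall>b \<in> M. z \<preceq> b) \<longrightarrow> z \<preceq> a" "a \<in> carrier A"
      using ab(1) unfolding generated_def by blast
    have "\<forall>z \<in> carrier A. (\<forall>b \<in> M. z \<preceq> b) \<longrightarrow> z \<preceq> b" using M(3,4) ab(2,3) le_trans by blast
    then show ?thesis using M(1,2) ab(3) unfolding generated_def by blast
  qed
  moreover have "generated B \<subseteq> carrier A" unfolding generated_def by blast
  ultimately show ?thesis unfolding filters_def by blast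
qed

lemma subset_generated: "B \<subseteq> carrier A \<Longrightarrow> B \<subseteq> generated B"
proof
  fix b assume "B \<subseteq> carrier A" "b \<in> B"
  then show "b \<in> generated B" unfolding generated_def by (auto intro!: exI[of _ "{b}"])
qed

lemma filter_lower_bound:
  assumes F: "F \<in> filters" and M: "finite M" "M \<subseteq> F"
  obtains z where "z \<in> F" "\<forall>b \<in> M. z \<preceq> b"
proof -
  note [simp] = subsetD[OF filterD(1)[OF F]]
  have "\<exists>z \<in> F. \<forall>b \<in> M. z \<preceq> b" using M
  proof (induction M)
    case empty
    then show ?case using filterD(2)[OF F] by blast
  next
    case (insert b M)
    then obtain z where z: "z \<in> F" "\<forall>b \<in> M. z \<preceq> b" by blast
    have "z \<otimes> b \<preceq> c" if "c \<in> insert b M" for c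
    proof (cases "c = b")
      case True then show ?thesis using insert.prems z by (auto intro: mult_le2)
    next
      case False
      then have "z \<preceq> c" "c \<in> F" using that z insert.prems by auto
      then show ?thesis using le_trans[OF mult_le1] insert.prems z by simp
    qed
    then show ?case using filterD(3)[OF F z(1), of b] insert.prems by blast
  qed
  then show thesis using that by blast
qed

lemma mem_filter_of_bound:
  assumes F: "F \<in> filters" and M: "finite M" "M \<subseteq> F"
    and a: "a \<in> carrier A" "\<forall>z \<in> carrier A. (\<forall>b \<in> M. z \<preceq> b) \<longrightarrow> z \<preceq> a"
  shows "a \<in> F"
proof -
  obtain z where z: "z \<in> F" "\<forall>b \<in> M. z \<preceq> b" by (rule filter_lower_bound[OF F M])
  then have "z \<preceq> a" using a(2) filterD(1)[OF F] by blast
  then show ?thesis using filterD(4)[OF F z(1)] a(1) by blast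
qed

lemma generated_subset: "\<lbrakk>F \<in> filters; B \<subseteq> F\<rbrakk> \<Longrightarrow> generated B \<subseteq> F"
proof
  fix a assume F: "F \<in> filters" "B \<subseteq> F" and "a \<in> generated B"
  then obtain M where "finite M" "M \<subseteq> B" "a \<in> carrier A" "\<forall>z \<in> carrier A. (\<forall>b \<in> M. z \<preceq> b) \<longrightarrow> z \<preceq> a"
    unfolding generated_def by blast
  then show "a \<in> F" using mem_filter_of_bound[OF F(1), of M a] F(2) by blast
qed

lemma principal_filter: "a \<in> carrier A \<Longrightarrow> {b \<in> carrier A. a \<preceq> b} \<in> filters"
  unfolding filters_def by (auto intro: le_one le_mult le_trans)

end

section \<open>The space of irreducible filters\<close>

text \<open>
  Needed to apply the Alexander subbase theorem to a subset of a space.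
\<close>

lemma subtopology_subbase_topology:
  assumes "U \<subseteq> X"
  shows "subtopology (subbase_topology X \<K>) U = subbase_topology U \<K>"
proof -
  have "openin (subbase_topology Y \<K>) = arbitrary union_of (finite intersection_of (\<lambda>V. V \<in> \<K>) relative_to Y)" for Y
    unfolding subbase_topology_def openin_subbase by (rule ext) simp
  moreover have "X \<inter> U = U" using assms by blast
  ultimately have "openin (subtopology (subbase_topology X \<K>) U) = openin (subbase_topology U \<K>)"
    unfolding openin_relative_to[symmetric] by (simp add: arbitrary_union_of_relative_to)
  then show ?thesis by (simp add: topology_eq fun_eq_iff)
qed

text \<open>
  The points may be of any type that has room for the irreducible filters; \<open>\<phi> p\<close> is the filter named
  by \<open>p\<close>.
\<close>

locale irreducible_filter_points = semilattice_with_top A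
  for A :: "('a, 'z) monoid_scheme" (structure) +
  fixes X :: "'b set" and \<phi> :: "'b \<Rightarrow> 'a set"
  assumes \<phi>_bij: "bij_betw \<phi> X irreducible_filters"
begin

definition \<beta> :: "'a \<Rightarrow> 'b set" where
  "\<beta> a = {p \<in> X. a \<in> \<phi> p}"

definition \<K> :: "'b set set" where
  "\<K> = (\<lambda>a. X - \<beta> a) ` carrier A"

lemma \<phi>_irreducible: "p \<in> X \<Longrightarrow> \<phi> p \<in> irreducible_filters"
  using \<phi>_bij bij_betwE by blast

lemma \<phi>_filter: "p \<in> X \<Longrightarrow> \<phi> p \<in> filters"
  using \<phi>_irreducible irreducible_filterD(1) by blast

lemma point_of_filter:
  assumes "P \<in> irreducible_filters"
  obtains p where "p \<in> X" "\<phi> p = P"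
  using assms \<phi>_bij unfolding bij_betw_def by (metis imageE)

lemma \<beta>_subset: "\<beta> a \<subseteq> X"
  unfolding \<beta>_def by blast

lemma \<K>_subset: "\<K> \<subseteq> Pow X"
  unfolding \<K>_def by blast

lemma co_subbase_\<K>: "co_subbase X \<K> = \<beta> ` carrier A"
proof -
  have "X - (X - \<beta> a) = \<beta> a" for a using \<beta>_subset by (rule double_diff) simp
  then show ?thesis unfolding co_subbase_def \<K>_def by (auto simp: image_iff)
qed

lemma \<beta>_one: "\<beta> \<one> = X"
  unfolding \<beta>_def using filterD(2)[OF \<phi>_filter] by blast

lemma \<beta>_mult:
  assumes a: "a \<in> carrier A" and b: "b \<in> carrier A"
  shows "\<beta> (a \<otimes> b) = \<beta> a \<inter> \<beta> b"
proof -
  have "a \<otimes> b \<in> \<phi> p \<longleftrightarrow> a \<in> \<phi> p \<and> b \<in> \<phi> p" if p: "p \<in> X" for p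
    using filterD(3,4)[OF \<phi>_filter[OF p]] mult_le1[OF a b] mult_le2[OF a b] a b by blast
  then show ?thesis unfolding \<beta>_def by blast
qed

text \<open>
  If \<open>a\<close> is not below \<open>b\<close>, then the principal filter of \<open>a\<close> omits \<open>b\<close>, and so does some irreducible filter
  extending it.
\<close>

lemma \<beta>_subset_iff:
  assumes a: "a \<in> carrier A" and b: "b \<in> carrier A"
  shows "\<beta> a \<subseteq> \<beta> b \<longleftrightarrow> a \<preceq> b"
proof
  assume "a \<preceq> b"
  then show "\<beta> a \<subseteq> \<beta> b"
    unfolding \<beta>_def using filterD(4)[OF \<phi>_filter] b by blast
next
  assume sub: "\<beta> a \<subseteq> \<beta> b"
  show "a \<preceq> b"
  proof (rule ccontr)
    assume "\<not> a \<preceq> b"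
    then obtain P where P: "P \<in> irreducible_filters" "{c \<in> carrier A. a \<preceq> c} \<subseteq> P" "b \<notin> P"
      using irreducible_separation[OF principal_filter[OF a] b] by blast
    obtain p where p: "p \<in> X" "\<phi> p = P" by (rule point_of_filter[OF P(1)])
    have "p \<in> \<beta> a" using p P(2) le_refl[OF a] a unfolding \<beta>_def by blast
    then show False using sub P(3) p unfolding \<beta>_def by blast
  qed
qed

lemma \<beta>_bij: "bij_betw \<beta> (carrier A) (co_subbase X \<K>)"
  unfolding bij_betw_def co_subbase_\<K>
proof (intro conjI refl inj_onI)
  fix a b assume ab: "a \<in> carrier A" "b \<in> carrier A" "\<beta> a = \<beta> b"
  then have "a \<preceq> b" "b \<preceq> a" using \<beta>_subset_iff by blast+
  then show "a = b" unfolding sle_def using m_comm ab by metis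
qed

lemma openin_compl_\<beta>: "a \<in> carrier A \<Longrightarrow> openin (subbase_topology X \<K>) (X - \<beta> a)"
  unfolding \<K>_def by (rule openin_subbase_member) auto

lemma t0: "t0_space (subbase_topology X \<K>)"
  unfolding t0_space_def topspace_subbase_topology
proof (intro ballI impI)
  fix x y assume xy: "x \<in> X" "y \<in> X" "x \<noteq> y"
  then have "\<phi> x \<noteq> \<phi> y" using \<phi>_bij by (auto simp: bij_betw_def dest: inj_onD)
  moreover have "\<phi> x \<subseteq> carrier A" "\<phi> y \<subseteq> carrier A" using \<phi>_filter xy filterD(1) by blast+
  ultimately obtain a where "a \<in> carrier A" "a \<in> \<phi> x \<longleftrightarrow> a \<notin> \<phi> y" by blast
  then show "\<exists>U. openin (subbase_topology X \<K>) U \<and> (x \<notin> U \<longleftrightarrow> y \<in> U)"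
    using xy openin_compl_\<beta> by (intro exI[of _ "X - \<beta> a"]) (auto simp: \<beta>_def)
qed

lemma Union_\<K>: "X = \<Union>\<K>"
proof
  show "X \<subseteq> \<Union>\<K>"
  proof
    fix p assume p: "p \<in> X"
    then have "\<phi> p \<subseteq> carrier A" "\<phi> p \<noteq> carrier A"
      using filterD(1)[OF \<phi>_filter] irreducible_filterD(2)[OF \<phi>_irreducible] by blast+
    then obtain a where "a \<in> carrier A" "a \<notin> \<phi> p" by blast
    then show "p \<in> \<Union>\<K>" using p unfolding \<K>_def \<beta>_def by blast
  qed
qed (use \<K>_subset in blast)

text \<open>
  By the Alexander subbase theorem only covers by sets \<open>X - \<beta>(b)\<close>, \<open>b \<in> B\<close>, matter. A filter that contains
  \<open>B\<close> and omits \<open>a\<close> could be extended to an irreducible one, which would be an uncovered point. Hence \<open>a\<close>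
  lies in the filter generated by \<open>B\<close>, and the finitely many elements witnessing this give a subcover.
\<close>

lemma compactin_compl_\<beta>:
  assumes a: "a \<in> carrier A"
  shows "compactin (subbase_topology X \<K>) (X - \<beta> a)"
proof -
  let ?U = "X - \<beta> a"
  have "compact_space (subbase_topology ?U \<K>)"
  proof (rule Alexander_subbase_alt)
    show "?U \<subseteq> \<Union>\<K>" using a unfolding \<K>_def by blast
    show "topology (arbitrary union_of (finite intersection_of (\<lambda>x. x \<in> \<K>) relative_to ?U)) = subbase_topology ?U \<K>"
      unfolding subbase_topology_def ..
    fix \<C> assume \<C>: "\<C> \<subseteq> \<K>" "?U \<subseteq> \<Union>\<C>"
    define B where "B = {b \<in> carrier A. X - \<beta> b \<in> \<C>}"
    have "a \<in> generated B"
    proof (rule ccontr)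
      assume "a \<notin> generated B"
      then obtain P where P: "P \<in> irreducible_filters" "generated B \<subseteq> P" "a \<notin> P"
        by (rule irreducible_separation[OF generated_filter a])
      obtain p where p: "p \<in> X" "\<phi> p = P" by (rule point_of_filter[OF P(1)])
      then have "p \<in> \<Union>\<C>" using \<C>(2) P(3) unfolding \<beta>_def by blast
      then obtain b where b: "b \<in> carrier A" "X - \<beta> b \<in> \<C>" "p \<in> X - \<beta> b"
        using \<C>(1) unfolding \<K>_def by blast
      then have "b \<in> P" using P(2) subset_generated[of B] unfolding B_def by blast
      then show False using b(3) p unfolding \<beta>_def by blast
    qed
    then obtain M where M: "finite M" "M \<subseteq> B" "\<forall>z \<in> carrier A. (\<forall>b \<in> M. z \<preceq> b) \<longrightarrow> z \<preceq> a"
      unfolding generated_def by blast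
    have "?U \<subseteq> \<Union>((\<lambda>b. X - \<beta> b) ` M)"
    proof
      fix p assume p: "p \<in> ?U"
      have "\<not> M \<subseteq> \<phi> p"
        using mem_filter_of_bound[OF \<phi>_filter M(1) _ a M(3)] p unfolding \<beta>_def by blast
      then show "p \<in> \<Union>((\<lambda>b. X - \<beta> b) ` M)" using p unfolding \<beta>_def by blast
    qed
    moreover have "(\<lambda>b. X - \<beta> b) ` M \<subseteq> \<C>" using M(2) unfolding B_def by blast
    ultimately show "\<exists>\<C>'. finite \<C>' \<and> \<C>' \<subseteq> \<C> \<and> ?U \<subseteq> \<Union>\<C>'" using M(1) by blast
  qed
  then show ?thesis
    by (simp add: compactin_subspace subtopology_subbase_topology)
qed

text \<open>
  The set \<open>W\<close> comes from an element \<open>w\<close> of the filter of \<open>p\<close>, and \<open>D\<close> from an element \<open>d\<close> outside it: the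
  statement is \<open>irreducible_filter_witness\<close> read along \<open>\<beta>\<close>.
\<close>

lemma subbase_interpolation:
  assumes U: "U \<in> \<K>" and V: "V \<in> \<K>" and p: "p \<in> U \<inter> V"
  shows "\<exists>W \<in> \<K>. \<exists>D \<in> \<K>. p \<notin> W \<and> p \<in> D \<and> D \<subseteq> (U \<inter> V) \<union> W"
proof -
  obtain a b where ab: "a \<in> carrier A" "b \<in> carrier A" "U = X - \<beta> a" "V = X - \<beta> b"
    using U V unfolding \<K>_def by blast
  have pX: "p \<in> X" and "a \<notin> \<phi> p" "b \<notin> \<phi> p" using p ab unfolding \<beta>_def by blast+
  then obtain w d where wd: "w \<in> \<phi> p" "d \<in> carrier A" "d \<notin> \<phi> p" "w \<otimes> a \<preceq> d" "w \<otimes> b \<preceq> d"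
    using irreducible_filter_witness[OF \<phi>_irreducible[OF pX] ab(1) _ ab(2)] by blast
  have w: "w \<in> carrier A" using wd(1) filterD(1)[OF \<phi>_filter[OF pX]] by blast
  have "\<beta> w \<inter> \<beta> a \<subseteq> \<beta> d" "\<beta> w \<inter> \<beta> b \<subseteq> \<beta> d"
    using wd w ab by (simp_all add: \<beta>_mult[symmetric] \<beta>_subset_iff)
  then have "X - \<beta> d \<subseteq> (U \<inter> V) \<union> (X - \<beta> w)" using ab by blast
  moreover have "p \<notin> X - \<beta> w" "p \<in> X - \<beta> d" using pX wd unfolding \<beta>_def by blast+
  moreover have "X - \<beta> w \<in> \<K>" "X - \<beta> d \<in> \<K>" using w wd(2) unfolding \<K>_def by blast+
  ultimately show ?thesis by (intro bexI[of _ "X - \<beta> w"] bexI[of _ "X - \<beta> d"] conjI)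
qed

text \<open>
  This is \<open>irreducible_extension\<close> read along \<open>\<beta>\<close>: the set \<open>Y\<close> consists of the points
  extending a filter, \<open>Y \<subseteq> \<beta>(w)\<close> means that \<open>w\<close> belongs to this filter, and the family \<open>\<J>\<close> corresponds to
  a set that is directed modulo the filter and disjoint from it.
\<close>

lemma Y_family_avoided:
  assumes Y: "Y \<in> closed_inters X \<K>" and fam: "Y_family X \<K> Y \<J>"
    and meets: "\<And>U. U \<in> \<J> \<Longrightarrow> Y \<inter> (X - U) \<noteq> {}"
  shows "Y \<inter> \<Inter>{X - U |U. U \<in> \<J>} \<noteq> {}"
proof -
  obtain \<A> where \<A>: "\<A> \<subseteq> co_subbase X \<K>" "Y = X \<inter> \<Inter>\<A>"
    using Y unfolding closed_inters_def by blast
  define B where "B = {b \<in> carrier A. \<beta> b \<in> \<A>}"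
  define J where "J = {a \<in> carrier A. \<beta> a \<in> \<J>}"
  have \<A>_eq: "\<A> = \<beta> ` B" using \<A>(1) unfolding co_subbase_\<K> B_def by blast
  have \<J>_sub: "\<J> \<subseteq> co_subbase X \<K>" and \<J>_ne: "\<J> \<noteq> {}" using fam unfolding Y_family_def by blast+
  have \<J>_eq: "\<J> = \<beta> ` J" using \<J>_sub unfolding co_subbase_\<K> J_def by blast
  have Y_iff: "p \<in> Y \<longleftrightarrow> generated B \<subseteq> \<phi> p" if p: "p \<in> X" for p
  proof -
    have "p \<in> Y \<longleftrightarrow> B \<subseteq> \<phi> p" using p unfolding \<A>(2) \<A>_eq \<beta>_def by blast
    also have "\<dots> \<longleftrightarrow> generated B \<subseteq> \<phi> p"
    proof
      show "generated B \<subseteq> \<phi> p" if "B \<subseteq> \<phi> p" by (rule generated_subset[OF \<phi>_filter[OF p] that])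
      show "B \<subseteq> \<phi> p" if "generated B \<subseteq> \<phi> p"
        using that subset_generated[of B] unfolding B_def by blast
    qed
    finally show ?thesis .
  qed
  \<comment> \<open>The sets \<open>H \<supseteq> Y\<close> in the definition of a \<open>Y\<close>-family come from elements of the filter.\<close>
  have mem_generated: "w \<in> generated B" if w: "w \<in> carrier A" "Y \<subseteq> \<beta> w" for w
  proof (rule ccontr)
    assume "w \<notin> generated B"
    then obtain P where P: "P \<in> irreducible_filters" "generated B \<subseteq> P" "w \<notin> P"
      by (rule irreducible_separation[OF generated_filter w(1)])
    obtain p where p: "p \<in> X" "\<phi> p = P" by (rule point_of_filter[OF P(1)])
    then have "p \<in> Y" using Y_iff P(2) by blast
    then show False using w(2) P(3) p(2) unfolding \<beta>_def by blast
  qed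
  have "\<exists>P \<in> irreducible_filters. generated B \<subseteq> P \<and> P \<inter> J = {}"
  proof (rule irreducible_extension[OF generated_filter[of B], of J])
    show "J \<subseteq> carrier A" unfolding J_def by blast
    show "J \<noteq> {}" using \<J>_ne \<J>_eq by blast
    have "a \<notin> generated B" if "a \<in> J" for a
    proof
      assume "a \<in> generated B"
      then have "Y \<subseteq> \<beta> a" using Y_iff unfolding \<A>(2) \<beta>_def by blast
      then show False using meets[of "\<beta> a"] that \<J>_eq by blast
    qed
    then show "generated B \<inter> J = {}" by blast
    fix a b assume ab: "a \<in> J" "b \<in> J"
    then have "\<beta> a \<in> \<J>" "\<beta> b \<in> \<J>" unfolding J_def by blast+
    then have "\<exists>H \<in> co_subbase X \<K>. \<exists>C \<in> \<J>. Y \<subseteq> H \<and> \<beta> a \<inter> H \<subseteq> C \<and> \<beta> b \<inter> H \<subseteq> C"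
      using fam unfolding Y_family_def by blast
    then obtain w c where wc: "w \<in> carrier A" "c \<in> J" "Y \<subseteq> \<beta> w" "\<beta> a \<inter> \<beta> w \<subseteq> \<beta> c" "\<beta> b \<inter> \<beta> w \<subseteq> \<beta> c"
      unfolding co_subbase_\<K> \<J>_eq by blast
    have "a \<in> carrier A" "b \<in> carrier A" "c \<in> carrier A" using ab wc(2) unfolding J_def by blast+
    then have "a \<otimes> w \<preceq> c" "b \<otimes> w \<preceq> c"
      using wc by (simp_all add: \<beta>_mult[symmetric] \<beta>_subset_iff)
    then show "\<exists>w \<in> generated B. \<exists>c \<in> J. a \<otimes> w \<preceq> c \<and> b \<otimes> w \<preceq> c"
      using mem_generated[OF wc(1,3)] wc(2) by blast
  qed blast
  then obtain P where P: "P \<in> irreducible_filters" "generated B \<subseteq> P" "P \<inter> J = {}" by blast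
  obtain p where p: "p \<in> X" "\<phi> p = P" by (rule point_of_filter[OF P(1)])
  have "p \<in> Y" using Y_iff p P(2) by blast
  moreover have "p \<notin> \<beta> a" if "a \<in> J" for a using that p P(3) unfolding \<beta>_def by blast
  ultimately show ?thesis using p(1) unfolding \<J>_eq by blast
qed

lemma s_space: "s_space X \<K>"
proof -
  have "U \<union> V \<in> \<K>" if UV: "U \<in> \<K>" "V \<in> \<K>" for U V
  proof -
    obtain a b where ab: "a \<in> carrier A" "b \<in> carrier A" "U = X - \<beta> a" "V = X - \<beta> b"
      using UV unfolding \<K>_def by blast
    then have "U \<union> V = X - \<beta> (a \<otimes> b)" by (simp add: \<beta>_mult Diff_Int)
    then show ?thesis using ab unfolding \<K>_def by blast
  qed
  moreover have "{} \<in> \<K>" unfolding \<K>_def using \<beta>_one by (auto intro!: image_eqI[of _ _ \<one>])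
  moreover have "compactin (subbase_topology X \<K>) U" if "U \<in> \<K>" for U
    using that compactin_compl_\<beta> by (auto simp: \<K>_def)
  ultimately show ?thesis
    unfolding s_space_def using \<K>_subset t0 Union_\<K> subbase_interpolation Y_family_avoided by (intro conjI ballI allI impI) (simp_all; fail)+
qed

text \<open>
  The largest \<open>R \<subseteq> X \<times> \<Z>(X)\<close> for which \<open>\<beta>(f(a)) \<subseteq> m\<^sub>R(\<beta>(a))\<close> holds for all \<open>a\<close>.
\<close>

definition dual_multirelation :: "('a \<Rightarrow> 'a) \<Rightarrow> ('b \<times> 'b set) set" where
  "dual_multirelation f = {(p, Z) \<in> X \<times> sat_sets X \<K>. \<forall>a \<in> carrier A. f a \<in> \<phi> p \<longrightarrow> Z \<inter> \<beta> a \<noteq> {}}"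

text \<open>
  Only one inclusion needs an argument. If \<open>f a\<close> is not in the filter of \<open>p\<close>, then the set \<open>X - \<beta>(a)\<close>,
  which misses \<open>\<beta>(a)\<close>, is related to \<open>p\<close>: it misses \<open>\<beta>(b)\<close> only for \<open>b\<close> below \<open>a\<close>, and then \<open>f b\<close> is not
  in the filter either, by monotonicity.
\<close>

lemma m_op_dual_multirelation:
  assumes f: "\<And>a. a \<in> carrier A \<Longrightarrow> f a \<in> carrier A"
    and mono: "\<And>a b. \<lbrakk>a \<in> carrier A; b \<in> carrier A; a \<preceq> b\<rbrakk> \<Longrightarrow> f a \<preceq> f b"
    and a: "a \<in> carrier A"
  shows "m_op X \<K> (dual_multirelation f) (\<beta> a) = \<beta> (f a)"
proof
  show "\<beta> (f a) \<subseteq> m_op X \<K> (dual_multirelation f) (\<beta> a)"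
    using a unfolding m_op_def dual_multirelation_def hits_def \<beta>_def[of "f a"] by blast
  show "m_op X \<K> (dual_multirelation f) (\<beta> a) \<subseteq> \<beta> (f a)"
  proof
    fix p assume "p \<in> m_op X \<K> (dual_multirelation f) (\<beta> a)"
    then have p: "p \<in> X" and sub: "dual_multirelation f `` {p} \<subseteq> hits X \<K> (\<beta> a)" unfolding m_op_def by blast+
    have "X - \<beta> a \<in> sat_sets X \<K>"
      unfolding sat_sets_def \<K>_def using a by (auto intro!: exI[of _ "{X - \<beta> a}"])
    moreover have "X - \<beta> a \<notin> hits X \<K> (\<beta> a)" unfolding hits_def by blast
    ultimately have "\<not> (\<forall>b \<in> carrier A. f b \<in> \<phi> p \<longrightarrow> (X - \<beta> a) \<inter> \<beta> b \<noteq> {})"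
      using sub p unfolding dual_multirelation_def by blast
    then obtain b where b: "b \<in> carrier A" "f b \<in> \<phi> p" "(X - \<beta> a) \<inter> \<beta> b = {}" by blast
    then have "\<beta> b \<subseteq> \<beta> a" using \<beta>_subset by blast
    then have "f b \<preceq> f a" using mono a b(1) \<beta>_subset_iff by blast
    then have "f a \<in> \<phi> p" using filterD(4)[OF \<phi>_filter[OF p] b(2)] f[OF a] by blast
    then show "p \<in> \<beta> (f a)" using p unfolding \<beta>_def by blast
  qed
qed

lemma mS_space_dual_multirelation:
  assumes f: "\<And>a. a \<in> carrier A \<Longrightarrow> f a \<in> carrier A"
    and mono: "\<And>a b. \<lbrakk>a \<in> carrier A; b \<in> carrier A; a \<preceq> b\<rbrakk> \<Longrightarrow> f a \<preceq> f b"
  shows "mS_space X \<K> (dual_multirelation f)"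
  unfolding mS_space_def
proof (intro conjI ballI)
  note m = m_op_dual_multirelation[OF f mono]
  show "s_space X \<K>" by (rule s_space)
  show "dual_multirelation f \<subseteq> X \<times> sat_sets X \<K>" unfolding dual_multirelation_def by blast
  show "m_op X \<K> (dual_multirelation f) U \<in> co_subbase X \<K>" if "U \<in> co_subbase X \<K>" for U
    using that m f unfolding co_subbase_\<K> by auto
  fix p assume p: "p \<in> X"
  have hits_eq: "{hits X \<K> U |U. U \<in> co_subbase X \<K> \<and> p \<in> m_op X \<K> (dual_multirelation f) U} =
      {hits X \<K> (\<beta> a) |a. a \<in> carrier A \<and> f a \<in> \<phi> p}"
    using m p unfolding co_subbase_\<K> by (auto simp: \<beta>_def)
  have "Z \<in> dual_multirelation f `` {p} \<longleftrightarrow> Z \<in> sat_sets X \<K> \<and> (\<forall>a \<in> carrier A. f a \<in> \<phi> p \<longrightarrow> Z \<in> hits X \<K> (\<beta> a))" for Z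
    using p unfolding dual_multirelation_def hits_def by blast
  then show "dual_multirelation f `` {p} =
      sat_sets X \<K> \<inter> \<Inter>{hits X \<K> U |U. U \<in> co_subbase X \<K> \<and> p \<in> m_op X \<K> (dual_multirelation f) U}"
    unfolding hits_eq by blast
qed

end

text \<open>
  Adjoint operators are monotone, so all four operators of \<open>A\<close> are represented by multirelations on the
  space of irreducible filters. The bound on \<open>Pow (carrier A)\<close> makes room for the points.
\<close>

lemma ex_dual_space:
  fixes A :: "'a eslata"
  assumes A: "is_eslata A" and small: "Pow (carrier A) \<lesssim> (UNIV :: 'b set)"
  obtains \<X> :: "'b es_space" and r where "subbase_representation \<X> A r"
proof -
  interpret semilattice_with_top A
    using A unfolding is_eslata_def by unfold_locales blast
  obtain j :: "'a set \<Rightarrow> 'b" where j: "inj_on j (Pow (carrier A))"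
    using small unfolding lepoll_def by blast
  have "irreducible_filters \<subseteq> Pow (carrier A)"
    using irreducible_filterD(1) filterD(1) by blast
  then have "bij_betw j irreducible_filters (j ` irreducible_filters)"
    unfolding bij_betw_def using inj_on_subset[OF j] by simp
  then interpret irreducible_filter_points A "j ` irreducible_filters" "inv_into irreducible_filters j"
    by unfold_locales (rule bij_betw_inv_into)
  let ?X = "j ` irreducible_filters"
  have maps: "opP A \<in> carrier A \<rightarrow> carrier A" "opG A \<in> carrier A \<rightarrow> carrier A"
      "opF A \<in> carrier A \<rightarrow> carrier A" "opH A \<in> carrier A \<rightarrow> carrier A"
    and adj: "adjoint_ops A (opP A) (opG A)" "adjoint_ops A (opF A) (opH A)"
    using A unfolding is_eslata_def by simp_all
  have mono_left: "f a \<preceq> f b" and mono_right: "g a \<preceq> g b"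
    if adj: "adjoint_ops A f g" and c: "f \<in> carrier A \<rightarrow> carrier A" "g \<in> carrier A \<rightarrow> carrier A"
      and ab: "a \<in> carrier A" "b \<in> carrier A" "a \<preceq> b" for f g a b
  proof -
    have fg: "f a \<in> carrier A" "f b \<in> carrier A" "g a \<in> carrier A" "g b \<in> carrier A"
      using c ab by auto
    have "b \<preceq> g (f b)" "f (g a) \<preceq> a"
      using adj ab fg le_refl unfolding adjoint_ops_def by blast+
    then have "a \<preceq> g (f b)" "f (g a) \<preceq> b"
      using le_trans ab fg c by (blast intro: funcset_mem)+
    then show "f a \<preceq> f b" "g a \<preceq> g b"
      using adj ab fg unfolding adjoint_ops_def by blast+
  qed
  note mono = mono_left[OF adj(1) maps(1,2)] mono_right[OF adj(1) maps(1,2)]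
    mono_left[OF adj(2) maps(3,4)] mono_right[OF adj(2) maps(3,4)]
  let ?space = "\<lparr>points = ?X, subbase = \<K>, relI1 = dual_multirelation (opP A), relD1 = dual_multirelation (opG A),
    relI2 = dual_multirelation (opF A), relD2 = dual_multirelation (opH A)\<rparr>"
  have "subbase_representation ?space A \<beta>"
    by unfold_locales
      (simp_all add: eslata_closed[OF A] mono mS_space_dual_multirelation m_op_dual_multirelation \<beta>_bij \<beta>_one \<beta>_mult)
  then show thesis by (rule that)
qed

section \<open>The dual equivalence\<close>

lemma category_ESLata: "category (ESLata \<U>)"
proof -
  have comp: "compose (carrier A) g f \<in> eslata_hom A C"
    if A: "is_eslata A" and fg: "f \<in> eslata_hom A B" "g \<in> eslata_hom B C" for A B C :: "'a eslata" and f g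
  proof -
    have "f x \<in> carrier B" if "x \<in> carrier A" for x
      using fg(1) that unfolding eslata_hom_def by (auto simp: hom_def)
    then show ?thesis
      using fg eslata_closed[OF A] unfolding eslata_hom_def hom_def by (auto simp: compose_eq)
  qed
  have idt: "restrict (\<lambda>x. x) (carrier A) \<in> eslata_hom A A" if "is_eslata A" for A :: "'a eslata"
    using eslata_closed[OF that] unfolding eslata_hom_def hom_def by auto
  have maps: "f \<in> carrier A \<rightarrow> carrier B" "f \<in> extensional (carrier A)" if "f \<in> eslata_hom A B"
    for A B :: "'a eslata" and f
    using that unfolding eslata_hom_def by (auto simp: hom_def)
  have "compose (carrier A) f (restrict (\<lambda>x. x) (carrier A)) = f" 
    "compose (carrier A) (restrict (\<lambda>x. x) (carrier B)) f = f" if "f \<in> eslata_hom A B"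
    for A B :: "'a eslata" and f
    using maps[OF that] by (auto intro!: extensionalityI[of _ "carrier A"] simp: compose_eq)
  moreover have "compose (carrier A) (compose (carrier B) h g) f = compose (carrier A) h (compose (carrier A) g f)"
    if "f \<in> eslata_hom A B" for A B :: "'a eslata" and f and g h :: "'a \<Rightarrow> 'a"
    by (rule compose_assoc[OF maps(1)[OF that], symmetric])
  ultimately show ?thesis
    unfolding category_def ESLata_def using comp idt by simp
qed

lemma category_op_cat:
  assumes "category C"
  shows "category (op_cat C)"
  using assms unfolding category_def op_cat_def by simp

text \<open>
  The links are the triples of a space, an algebra and an isomorphism between the algebra and the
  complements of the subbase of the space.
\<close>

theorem theorem5p1:
  fixes \<U> :: "'a set set"
  assumes "\<And>A. A \<in> \<U> \<Longrightarrow> Pow A \<lesssim> (UNIV :: 'b set)"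
  shows "dually_equivalent (ESLata \<U>) (ESLataSp \<U> :: ('b es_space, ('b \<times> 'b) set) cat)"
proof -
  define L :: "('b es_space \<times> 'a eslata \<times> ('a \<Rightarrow> 'b set)) set"
    where "L = {(\<X>, A, r). subbase_representation \<X> A r \<and> is_eslata A \<and> carrier A \<in> \<U>}"
  let ?C = "op_cat (ESLata \<U>)" and ?D = "ESLataSp \<U> :: ('b es_space, ('b \<times> 'b) set) cat"
  have rep: "subbase_representation \<X> A r" if "(\<X>, A, r) \<in> L" for \<X> A r
    using that unfolding L_def by simp
  have in_L: "(\<X>, A, r) \<in> L" if "subbase_representation \<X> A r" "is_eslata A \<or> is_eslata_space \<X>" "carrier A \<in> \<U>"
    for \<X> A r
    using that subbase_representation.is_eslata_iff_is_eslata_space[OF that(1)] unfolding L_def by blast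
  have sources: "fst ` L = Obj ?D"
  proof (intro equalityI subsetI)
    fix \<X> assume "\<X> \<in> fst ` L"
    then obtain A r where "subbase_representation \<X> A r" and A: "is_eslata A" "carrier A \<in> \<U>"
      unfolding L_def by auto
    then interpret subbase_representation \<X> A r by simp
    show "\<X> \<in> Obj ?D"
      using is_eslata_iff_is_eslata_space A subbase_eqpoll_carrier unfolding ESLataSp_def by auto
  next
    fix \<X> assume "\<X> \<in> Obj ?D"
    then obtain C where \<X>: "is_eslata_space \<X>" "subbase \<X> \<approx> C" "C \<in> \<U>"
      unfolding ESLataSp_def by auto
    obtain A :: "'a eslata" and r where "subbase_representation \<X> A r" "carrier A = C"
      by (rule ex_dual_algebra[OF \<X>(1,2)])
    then have "(\<X>, A, r) \<in> L" using in_L \<X> by blast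
    then show "\<X> \<in> fst ` L" by (force simp: image_iff)
  qed
  have targets: "(\<lambda>l. fst (snd l)) ` L = Obj ?C"
  proof (intro equalityI subsetI)
    fix A assume "A \<in> (\<lambda>l. fst (snd l)) ` L"
    then show "A \<in> Obj ?C" unfolding L_def op_cat_def ESLata_def by auto
  next
    fix A assume "A \<in> Obj ?C"
    then have A: "is_eslata A" "carrier A \<in> \<U>" unfolding op_cat_def ESLata_def by auto
    obtain \<X> :: "'b es_space" and r where "subbase_representation \<X> A r"
      by (rule ex_dual_space[OF A(1) assms[OF A(2)]])
    then have "(\<X>, A, r) \<in> L" using in_L A by blast
    then show "A \<in> (\<lambda>l. fst (snd l)) ` L" by (force simp: image_iff)
  qed
  have ex_link: "\<exists>A r. (\<X>, A, r) \<in> L" if "\<X> \<in> Obj ?D" for \<X>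
  proof -
    obtain l where "l \<in> L" "\<X> = fst l" using \<open>\<X> \<in> Obj ?D\<close> unfolding sources[symmetric] by (rule imageE)
    then have "(\<X>, fst (snd l), snd (snd l)) \<in> L" by simp
    then show ?thesis by (intro exI)
  qed
  interpret linked_categories ?C ?D L fst "\<lambda>l. fst (snd l)" dual_hom
  proof
    show "category ?C" by (rule category_op_cat[OF category_ESLata])
    show "fst ` L = Obj ?D" "(\<lambda>l. fst (snd l)) ` L = Obj ?C" by (fact sources targets)+
    show "Idt ?D \<X> \<in> Hom ?D \<X> \<X>" if "\<X> \<in> Obj ?D" for \<X>
    proof -
      obtain A r where "(\<X>, A, r) \<in> L" using ex_link[OF \<open>\<X> \<in> Obj ?D\<close>] by blast
      then show ?thesis
        using subbase_representation.eslata_relation_dual_specialization[OF rep]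
        by (simp add: ESLataSp_def)
    qed
    show "Comp ?D \<X> \<Y> \<Z> T R \<in> Hom ?D \<X> \<Z>"
      if obs: "\<X> \<in> Obj ?D" "\<Y> \<in> Obj ?D" "\<Z> \<in> Obj ?D" and RT: "R \<in> Hom ?D \<X> \<Y>" "T \<in> Hom ?D \<Y> \<Z>" for \<X> \<Y> \<Z> R T
    proof -
      obtain A r B s C t where "(\<X>, A, r) \<in> L" "(\<Y>, B, s) \<in> L" "(\<Z>, C, t) \<in> L"
        using ex_link[OF obs(1)] ex_link[OF obs(2)] ex_link[OF obs(3)] by blast
      then interpret three_representations \<X> A r \<Y> B s \<Z> C t
        unfolding three_representations_def two_representations_def using rep by blast
      show ?thesis using eslata_relation_star_comp RT by (simp add: ESLataSp_def)
    qed
    fix l l' assume "l \<in> L" "l' \<in> L"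
    moreover obtain \<X> A r \<Y> B s where l: "l = (\<X>, A, r)" "l' = (\<Y>, B, s)"
      using prod_cases3 by metis
    ultimately interpret two_representations \<X> A r \<Y> B s
      unfolding two_representations_def using rep by blast
    show "bij_betw (dual_hom l l') (Hom ?D (fst l) (fst l')) (Hom ?C (fst (snd l)) (fst (snd l')))"
      using dual_hom_bij by (simp add: l ESLataSp_def op_cat_def ESLata_def)
    show "dual_hom l l (Idt ?D (fst l)) = Idt ?C (fst (snd l))"
      using dom.dual_hom_dual_specialization by (simp add: l ESLataSp_def op_cat_def ESLata_def)
    fix l'' R T assume "l'' \<in> L" and R: "R \<in> Hom ?D (fst l) (fst l')" and T: "T \<in> Hom ?D (fst l') (fst l'')"
    moreover obtain \<Z> C t where l'': "l'' = (\<Z>, C, t)"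
      by (rule prod_cases3)
    ultimately have Z: "(\<Z>, C, t) \<in> L" by simp
    interpret three_representations \<X> A r \<Y> B s \<Z> C t
      unfolding three_representations_def two_representations_def
      using rep[OF Z] dom.subbase_representation_axioms cod.subbase_representation_axioms by blast
    show "dual_hom l l'' (Comp ?D (fst l) (fst l') (fst l'') T R) =
        Comp ?C (fst (snd l)) (fst (snd l')) (fst (snd l'')) (dual_hom l' l'' T) (dual_hom l l' R)"
      using dual_hom_star_comp[of R T] R T by (simp add: l l'' ESLataSp_def op_cat_def ESLata_def)
  qed
  show ?thesis
    unfolding dually_equivalent_def by (rule equivalence)
qed

end
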